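(* Let $\mathcal{L}$ be a Lévy operator with a kernel $J$ satisfying $J(x,y)\le c|x-y|^{-N}$ for $|x-y|<1$, for some $c>0$. Then $\mathcal{L}$ cannot be supercontractive.
   Context: $L^p=L^p(\mathbb{R}^N)$ with Lebesgue measure and norm $\|\cdot\|_p$. A Lévy operator is $\mathcal{L}f(x)=\mathrm{P.V.}\int_{\mathbb{R}^N}(f(x)-f(y))J(x,y)\,dy$ with $J\ge0$ measurable, $J(x,y)=J(y,x)$ and $\sup_x\int J(x,y)\min\{1,|x-y|^2\}\,dy<\infty$. Set $\mathcal{E}(f,g)=\frac12\iint (f(x)-f(y))(g(x)-g(y))J(x,y)\,dx\,dy$ and $H_{\mathcal{L}}(\mathbb{R}^N)=\{f\in L^2:\mathcal{E}(f,f)<\infty\}$; $\mathcal{L}$ is understood as the self-adjoint operator on $L^2$ given by $\langle\mathcal{L}f,g\rangle=\mathcal{E}(f,g)$. For $u_0\in L^2$, the solution of $\partial_tu+\mathcal{L}u=0$, $u(0)=u_0$, is the unique $u\in C([0,\infty);L^2)\cap C^1((0,\infty);L^2)\cap C((0,\infty);H_{\mathcal{L}})$ satisfying $\frac{du}{dt}+\mathcal{L}u=0$ in $(0,\infty)$ and $u(0)=u_0$. $\mathcal{L}$ is supercontractive if there is a (finite) function $B(t,q)\ge0$ such that $\|u(t)\|_q\le B(t,q)\|u_0\|_2$ for every $2\le q<\infty$, every $t>0$ and every $u_0\in L^2$. *)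

theory Defs
  imports "HOL-Analysis.Analysis"
begin

text \<open>
  The space R^N is an arbitrary Euclidean space \<open>'a\<close>, with \<open>N = DIM('a)\<close>. Elements of
  L^p are represented by real-valued Lebesgue measurable functions; equality in L^p is equality
  almost everywhere.
\<close>

definition Lp_space :: "real \<Rightarrow> ('a::euclidean_space \<Rightarrow> real) set" where
  "Lp_space p = {f \<in> borel_measurable lebesgue. integrable lebesgue (\<lambda>x. \<bar>f x\<bar> powr p)}"

text \<open>Only meaningful on \<open>Lp_space p\<close>: the Bochner integral of a non-integrable function is 0.\<close>

definition Lp_norm :: "real \<Rightarrow> ('a::euclidean_space \<Rightarrow> real) \<Rightarrow> real" where
  "Lp_norm p f = (\<integral>x. \<bar>f x\<bar> powr p \<partial>lebesgue) powr (1 / p)"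

text \<open>
  Joint Lebesgue measurability makes the section \<open>J x\<close> measurable for almost every \<open>x\<close> only; for
  the remaining \<open>x\<close> the integral below is the lower integral.
\<close>

definition levy_kernel :: "('a::euclidean_space \<Rightarrow> 'a \<Rightarrow> real) \<Rightarrow> bool" where
  "levy_kernel J \<longleftrightarrow>
     (\<lambda>(x, y). J x y) \<in> borel_measurable lebesgue \<and>
     (\<forall>x y. 0 \<le> J x y) \<and>
     (\<forall>x y. J x y = J y x) \<and>
     (SUP x. \<integral>\<^sup>+ y. ennreal (J x y * min 1 ((norm (x - y))\<^sup>2)) \<partial>lebesgue) < \<infinity>"

definition energy ::
  "('a::euclidean_space \<Rightarrow> 'a \<Rightarrow> real) \<Rightarrow> ('a \<Rightarrow> real) \<Rightarrow> ('a \<Rightarrow> real) \<Rightarrow> real" where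
  "energy J f g = 1 / 2 * (\<integral>(x, y). (f x - f y) * (g x - g y) * J x y \<partial>lebesgue)"

definition H_space :: "('a::euclidean_space \<Rightarrow> 'a \<Rightarrow> real) \<Rightarrow> ('a \<Rightarrow> real) set" where
  "H_space J =
     {f \<in> Lp_space 2. integrable lebesgue (\<lambda>(x, y). (f x - f y) * (f x - f y) * J x y)}"

definition H_norm :: "('a::euclidean_space \<Rightarrow> 'a \<Rightarrow> real) \<Rightarrow> ('a \<Rightarrow> real) \<Rightarrow> real" where
  "H_norm J f = sqrt ((Lp_norm 2 f)\<^sup>2 + energy J f f)"

text \<open>
  \<open>levy_op J f h\<close> says that \<open>f\<close> lies in the domain of the self-adjoint operator on L^2 associated
  with the form \<open>energy J\<close>, and that \<open>h\<close> represents the value of the operator at \<open>f\<close>.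
\<close>

definition levy_op ::
  "('a::euclidean_space \<Rightarrow> 'a \<Rightarrow> real) \<Rightarrow> ('a \<Rightarrow> real) \<Rightarrow> ('a \<Rightarrow> real) \<Rightarrow> bool" where
  "levy_op J f h \<longleftrightarrow>
     f \<in> H_space J \<and> h \<in> Lp_space 2 \<and>
     (\<forall>g \<in> H_space J. (\<integral>x. h x * g x \<partial>lebesgue) = energy J f g)"

text \<open>Here \<open>v\<close> is the strong L^2 derivative \<open>du/dt\<close>.\<close>

definition levy_solution ::
  "('a::euclidean_space \<Rightarrow> 'a \<Rightarrow> real) \<Rightarrow> ('a \<Rightarrow> real) \<Rightarrow> (real \<Rightarrow> 'a \<Rightarrow> real) \<Rightarrow> bool" where
  "levy_solution J u0 u \<longleftrightarrow>
     (\<forall>t\<ge>0. u t \<in> Lp_space 2 \<and>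
        ((\<lambda>s. Lp_norm 2 (\<lambda>x. u s x - u t x)) \<longlongrightarrow> 0) (at t within {0..})) \<and>
     (\<forall>t>0. u t \<in> H_space J \<and>
        ((\<lambda>s. H_norm J (\<lambda>x. u s x - u t x)) \<longlongrightarrow> 0) (at t within {0<..})) \<and>
     (\<exists>v. (\<forall>t>0. v t \<in> Lp_space 2 \<and>
              ((\<lambda>s. Lp_norm 2 (\<lambda>x. (u s x - u t x) / (s - t) - v t x)) \<longlongrightarrow> 0)
                (at t within {0<..}) \<and>
              ((\<lambda>s. Lp_norm 2 (\<lambda>x. v s x - v t x)) \<longlongrightarrow> 0) (at t within {0<..}) \<and>
              levy_op J (u t) (\<lambda>x. - v t x))) \<and>
     (AE x in lebesgue. u 0 x = u0 x)"

text \<open>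
  For a Levy kernel the solution with data \<open>u0\<close> is unique up to null sets at each time, so
  \<open>u\<close> ranges over the representatives of the solution. Finiteness of the \<open>q\<close>-norm is stated as
  membership in \<open>Lp_space q\<close>.
\<close>

definition supercontractive :: "('a::euclidean_space \<Rightarrow> 'a \<Rightarrow> real) \<Rightarrow> bool" where
  "supercontractive J \<longleftrightarrow>
     (\<exists>B :: real \<Rightarrow> real \<Rightarrow> real.
        \<forall>t>0. \<forall>q\<ge>2. 0 \<le> B t q \<and>
          (\<forall>u0 \<in> Lp_space 2. \<forall>u. levy_solution J u0 u \<longrightarrow>
             u t \<in> Lp_space q \<and> Lp_norm q (u t) \<le> B t q * Lp_norm 2 u0))"

end

theory Submission
  imports Defs
begin

text \<open>
  Let \<open>f\<close> be a bump of height and width \<open>r = 2\<^sup>-\<^sup>n\<close>. The bound on \<open>J\<close> makes the Rayleigh quotient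
  \<open>\<E>(f,f) / \<parallel>f\<parallel>\<^sub>2\<^sup>2\<close> grow at most linearly in \<open>n\<close>, that is, logarithmically in \<open>1/r\<close>. By
  log-convexity of \<open>t \<mapsto> \<parallel>u(t)\<parallel>\<^sub>2\<^sup>2\<close>, the solution with data close to \<open>f\<close> satisfies
  \<open>\<langle>u(T), f\<rangle> \<ge> \<parallel>f\<parallel>\<^sub>2\<^sup>2 exp (- C T (1 + n)) / 4\<close>. On the other hand Hoelder's inequality and the
  \<open>L\<^sup>4\<close> bound of supercontractivity give
  \<open>\<langle>u(T), f\<rangle> \<le> B(T,4) \<parallel>f\<parallel>\<^sub>2\<^sup>2 \<bar>B\<^sub>r\<bar>\<^sup>1\<^sup>/\<^sup>4\<close>, which decays like \<open>2\<^sup>-\<^sup>n\<^sup>N\<^sup>/\<^sup>4\<close>. For small \<open>T\<close> the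
  two bounds are incompatible as \<open>n\<close> grows.

  Solutions have to be constructed, since supercontractivity says nothing about data without one.
  Data in the range of the squared resolvent suffice; for them the semigroup is a series in powers of
  \<open>1 - (1 + l A)\<^sup>-\<^sup>1\<close> whose coefficients are differences of Laguerre polynomials.
\<close>

section \<open>Series with Laguerre coefficients\<close>

text \<open>The exponent \<open>-N\<close> is the borderline. For a kernel comparable to
  \<open>norm (x - y) powr (- N - s)\<close> with \<open>0 < s < 2\<close> the quotient would grow
  like \<open>r powr (- s)\<close>, and its exponential would beat every power of \<open>r\<close>.
  At the borderline the flow up to time \<open>T\<close> costs a bump only a power of
  \<open>r\<close> whose exponent is proportional to \<open>T\<close>, while the \<open>L^4\<close>
  bound demands a fixed power. So a single exponent and a single time, chosen according to the
  kernel, decide the matter, and any finite \<open>B T 4\<close> loses against a geometric sequence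
  in \<open>n\<close>.

  The shape of the construction comes from the unboundedness of the generator \<open>A\<close>: its
  exponential is no power series in \<open>A\<close>, so it is expanded in the contraction
  \<open>S = 1 - R\<close> with \<open>R\<close> a resolvent. The coefficients are controlled only
  in the square summable sense and have to meet vectors whose norms are square summable. One factor
  \<open>R\<close> in the data supplies these, the second one puts the sum into the domain of
  \<open>A\<close>; this is where the square comes from. A small parameter of the resolvent then
  brings the data close to the bump.\<close>

definition laguerre :: "nat \<Rightarrow> real \<Rightarrow> real" where
  "laguerre n t = (\<Sum>k\<le>n. real (n choose k) * ((- t) ^ k / fact k))"

text \<open>The generalised Laguerre polynomial with parameter -1. The value 1 at index 0 amounts to
  reading the predecessor of \<open>laguerre 0\<close> as zero.\<close>

definition laguerre_diff :: "nat \<Rightarrow> real \<Rightarrow> real" where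
  "laguerre_diff n t = (case n of 0 \<Rightarrow> 1 | Suc m \<Rightarrow> laguerre (Suc m) t - laguerre m t)"

lemma laguerre_diff_simps [simp]:
  "laguerre_diff 0 t = 1"
  "laguerre_diff (Suc n) t = laguerre (Suc n) t - laguerre n t"
  by (simp_all add: laguerre_diff_def)

lemma laguerre_0 [simp]: "laguerre 0 t = 1"
  by (simp add: laguerre_def)

lemma laguerre_at_0 [simp]: "laguerre n 0 = 1"
  by (simp add: laguerre_def sum.atMost_shift)

lemma laguerre_diff_at_0: "laguerre_diff n 0 = (if n = 0 then 1 else 0)"
  by (cases n) auto

text \<open>Pascal's rule, once \<open>laguerre n\<close> is padded with the vanishing coefficient
  \<open>n choose Suc n\<close>. In this shifted form termwise differentiation returns
  \<open>- laguerre n t\<close>.\<close>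

lemma laguerre_diff_Suc_eq_sum:
  "laguerre (Suc n) t - laguerre n t = (\<Sum>k\<le>n. real (n choose k) * ((- t) ^ Suc k / fact (Suc k)))"
proof -
  have "laguerre n t = (\<Sum>k\<le>Suc n. real (n choose k) * ((- t) ^ k / fact k))"
    by (simp add: laguerre_def)
  then have "laguerre (Suc n) t - laguerre n t =
      (\<Sum>k\<le>Suc n. (real (Suc n choose k) - real (n choose k)) * ((- t) ^ k / fact k))"
    by (simp only: laguerre_def left_diff_distrib sum_subtractf)
  also have "\<dots> = (\<Sum>k\<le>n. real (n choose k) * ((- t) ^ Suc k / fact (Suc k)))"
    by (subst sum.atMost_Suc_shift) simp
  finally show ?thesis .
qed

lemma DERIV_laguerre_diff:
  "((\<lambda>t. laguerre (Suc n) t - laguerre n t) has_real_derivative - laguerre n t) (at t)"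
proof -
  have *: "((\<lambda>t. real (n choose k) * ((- t) ^ Suc k / fact (Suc k))) has_real_derivative
      - (real (n choose k) * ((- t) ^ k / fact k))) (at t)" for k
  proof -
    have f: "fact (Suc k) = (real (Suc k)) * fact k" by simp
    show ?thesis
      by (rule DERIV_cong[OF DERIV_cmult[OF DERIV_cdivide[OF DERIV_power[OF DERIV_minus[OF DERIV_ident]]]]])
        (simp add: f del: fact_Suc of_nat_Suc)
  qed
  have "- laguerre n t = (\<Sum>k\<le>n. - (real (n choose k) * ((- t) ^ k / fact k)))"
    unfolding laguerre_def sum_negf ..
  moreover have "((\<lambda>t. \<Sum>k\<le>n. real (n choose k) * ((- t) ^ Suc k / fact (Suc k))) has_real_derivative
      (\<Sum>k\<le>n. - (real (n choose k) * ((- t) ^ k / fact k)))) (at t)"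
    by (intro DERIV_sum *)
  ultimately show ?thesis
    unfolding laguerre_diff_Suc_eq_sum by simp
qed

lemma DERIV_laguerre_diff' [derivative_intros]:
  "(laguerre_diff n has_real_derivative (case n of 0 \<Rightarrow> 0 | Suc m \<Rightarrow> - laguerre m t)) (at t)"
  using DERIV_laguerre_diff by (cases n) (auto simp: laguerre_diff_def[abs_def])

text \<open>The squared partial sums obey \<open>\<Phi>' = \<Phi> - L\<^sub>M\<^sup>2\<close>, because
  \<open>2 (a - b) b = a\<^sup>2 - b\<^sup>2 - (a - b)\<^sup>2\<close> makes the derivative telescope.\<close>

lemma sum_laguerre_diff_squares_le:
  assumes "0 \<le> t"
  shows "(\<Sum>n<m. (laguerre_diff n t)\<^sup>2) \<le> exp t"
proof (cases m)
  case 0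
  then show ?thesis by simp
next
  case (Suc M)
  define \<Phi> where "\<Phi> t = (\<Sum>n<Suc M. (laguerre_diff n t)\<^sup>2)" for t
  have eq: "\<Phi> t = 1 + (\<Sum>n<M. (laguerre (Suc n) t - laguerre n t)\<^sup>2)" for t
    unfolding \<Phi>_def sum.lessThan_Suc_shift by simp
  have tele: "(\<Sum>n<M. 2 * (laguerre (Suc n) t - laguerre n t) * - laguerre n t) = \<Phi> t - (laguerre M t)\<^sup>2" for t
  proof -
    have "(\<Sum>n<M. 2 * (laguerre (Suc n) t - laguerre n t) * - laguerre n t) =
      (\<Sum>n<M. (laguerre (Suc n) t - laguerre n t)\<^sup>2 - ((laguerre (Suc n) t)\<^sup>2 - (laguerre n t)\<^sup>2))"
      by (intro sum.cong refl) (simp add: power2_eq_square algebra_simps)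
    also have "\<dots> = (\<Sum>n<M. (laguerre (Suc n) t - laguerre n t)\<^sup>2) -
        (\<Sum>n<M. (laguerre (Suc n) t)\<^sup>2 - (laguerre n t)\<^sup>2)"
      by (rule sum_subtractf)
    also have "\<dots> = \<Phi> t - (laguerre M t)\<^sup>2"
      unfolding sum_lessThan_telescope[of "\<lambda>n. (laguerre n t)\<^sup>2"] eq by simp
    finally show ?thesis .
  qed
  have d: "(\<Phi> has_real_derivative \<Phi> t - (laguerre M t)\<^sup>2) (at t)" for t
  proof -
    have "((\<lambda>t. 1 + (\<Sum>n<M. (laguerre (Suc n) t - laguerre n t)\<^sup>2)) has_real_derivative
       0 + (\<Sum>n<M. 2 * (laguerre (Suc n) t - laguerre n t) * - laguerre n t)) (at t)"
      by (intro DERIV_add DERIV_const DERIV_sum)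
        (rule DERIV_cong[OF DERIV_power[OF DERIV_laguerre_diff]], simp)
    then show ?thesis
      unfolding tele eq[abs_def, symmetric] by simp
  qed
  have "exp (- 0) * \<Phi> 0 \<ge> exp (- t) * \<Phi> t"
  proof (rule DERIV_nonpos_imp_nonincreasing[OF assms])
    fix x :: real
    show "\<exists>y. ((\<lambda>t. exp (- t) * \<Phi> t) has_real_derivative y) (at x) \<and> y \<le> 0"
    proof (intro exI conjI)
      show "((\<lambda>t. exp (- t) * \<Phi> t) has_real_derivative - (exp (- x) * (laguerre M x)\<^sup>2)) (at x)"
        by (rule derivative_eq_intros d refl)+ (simp add: algebra_simps)
    qed simp
  qed
  moreover have "\<Phi> 0 = 1" by (simp add: eq)
  ultimately have "\<Phi> t \<le> exp t"
    by (simp add: exp_minus field_simps)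
  then show ?thesis by (simp add: \<Phi>_def Suc)
qed

lemma summable_laguerre_diff_squares:
  assumes "0 \<le> t"
  shows "summable (\<lambda>n. (laguerre_diff n t)\<^sup>2)"
  using sum_laguerre_diff_squares_le[OF assms]
  by (intro summableI_nonneg_bounded[of _ "exp t"]) auto

lemma summable_scaleR_l2:
  fixes x :: "nat \<Rightarrow> 'h::banach"
  assumes "summable (\<lambda>n. (a n)\<^sup>2)" "summable (\<lambda>n. (norm (x n))\<^sup>2)"
  shows "summable (\<lambda>n. a n *\<^sub>R x n)"
proof (rule summable_comparison_test')
  show "summable (\<lambda>n. (a n)\<^sup>2 + (norm (x n))\<^sup>2)"
    by (intro summable_add assms)
  show "norm (a n *\<^sub>R x n) \<le> (a n)\<^sup>2 + (norm (x n))\<^sup>2" if "0 \<le> n" for n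
    using sum_squares_bound[of "\<bar>a n\<bar>" "norm (x n)"]
      mult_nonneg_nonneg[OF abs_ge_zero[of "a n"] norm_ge_zero[of "x n"]]
    unfolding norm_scaleR power2_abs by linarith
qed

lemma norm_sum_scaleR_le_l2:
  fixes x :: "'i \<Rightarrow> 'h::real_normed_vector"
  shows "norm (\<Sum>n\<in>I. a n *\<^sub>R x n) \<le> sqrt (\<Sum>n\<in>I. (a n)\<^sup>2) * sqrt (\<Sum>n\<in>I. (norm (x n))\<^sup>2)"
proof -
  have "norm (\<Sum>n\<in>I. a n *\<^sub>R x n) \<le> (\<Sum>n\<in>I. \<bar>a n\<bar> * \<bar>norm (x n)\<bar>)"
    by (rule order_trans[OF norm_sum]) simp
  also have "\<dots> \<le> L2_set a I * L2_set (\<lambda>n. norm (x n)) I"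
    by (rule L2_set_mult_ineq)
  finally show ?thesis by (simp add: L2_set_def)
qed

text \<open>On a bounded time interval the coefficients have uniformly bounded sums of squares, so
  by Cauchy-Schwarz a tail of the series is controlled by the tail of the squared norms of
  \<open>x\<close>. A Weierstrass majorant would ask for more than this square summability
  gives.\<close>

lemma uniform_limit_laguerre_series:
  fixes x :: "nat \<Rightarrow> 'h::banach"
  assumes "summable (\<lambda>n. (norm (x n))\<^sup>2)"
  shows "uniform_limit {0..b} (\<lambda>N t. \<Sum>n<N. laguerre_diff n t *\<^sub>R x n)
           (\<lambda>t. \<Sum>n. laguerre_diff n t *\<^sub>R x n) sequentially"
proof (rule uniform_limit_suminf, rule Cauchy_uniformly_convergent, rule uniformly_Cauchy_onI')
  fix e :: real assume "0 < e"
  then have "0 < (e / exp b)\<^sup>2" by simp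
  with assms obtain N where N: "\<And>m n. m \<ge> N \<Longrightarrow> norm (\<Sum>k=m..<n. (norm (x k))\<^sup>2) < (e / exp b)\<^sup>2"
    unfolding summable_Cauchy by metis
  show "\<exists>M. \<forall>t\<in>{0..b}. \<forall>m\<ge>M. \<forall>n>m. dist (\<Sum>k<m. laguerre_diff k t *\<^sub>R x k) (\<Sum>k<n. laguerre_diff k t *\<^sub>R x k) < e"
  proof (intro exI ballI allI impI)
    fix t m n assume t: "t \<in> {0..b}" and mn: "m \<ge> N" "(m::nat) < n"
    have "dist (\<Sum>k<m. laguerre_diff k t *\<^sub>R x k) (\<Sum>k<n. laguerre_diff k t *\<^sub>R x k) =
        norm (\<Sum>k=m..<n. laguerre_diff k t *\<^sub>R x k)"
      using sum_diff_nat_ivl[of 0 m n "\<lambda>k. laguerre_diff k t *\<^sub>R x k"] mn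
      by (subst dist_commute) (simp add: dist_norm atLeast0LessThan)
    also have "\<dots> \<le> sqrt (\<Sum>k=m..<n. (laguerre_diff k t)\<^sup>2) * sqrt (\<Sum>k=m..<n. (norm (x k))\<^sup>2)"
      by (rule norm_sum_scaleR_le_l2)
    also have "\<dots> \<le> exp b * sqrt (\<Sum>k=m..<n. (norm (x k))\<^sup>2)"
    proof (rule mult_right_mono)
      have "(\<Sum>k=m..<n. (laguerre_diff k t)\<^sup>2) \<le> (\<Sum>k<n. (laguerre_diff k t)\<^sup>2)"
        by (rule sum_mono2) auto
      also have "\<dots> \<le> exp t" using t by (intro sum_laguerre_diff_squares_le) auto
      also have "\<dots> \<le> exp b" using t by simp
      \<comment> \<open>Crude but affordable: \<open>b\<close> is nonnegative, and any bound uniform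
        in \<open>t\<close> serves.\<close>
      also have "\<dots> \<le> (exp b)\<^sup>2"
        using t by (simp add: power2_eq_square mult_left_mono)
      finally show "sqrt (\<Sum>k=m..<n. (laguerre_diff k t)\<^sup>2) \<le> exp b"
        by (simp add: real_le_lsqrt sum_nonneg)
    qed (simp add: sum_nonneg)
    also have "\<dots> < exp b * (e / exp b)"
    proof (rule mult_strict_left_mono)
      have "(\<Sum>k=m..<n. (norm (x k))\<^sup>2) < (e / exp b)\<^sup>2"
        using N[OF mn(1), of n] by (simp add: sum_nonneg)
      then show "sqrt (\<Sum>k=m..<n. (norm (x k))\<^sup>2) < e / exp b"
        using \<open>0 < e\<close> by (intro real_less_lsqrt) (auto simp: sum_nonneg)
    qed simp
    finally show "dist (\<Sum>k<m. laguerre_diff k t *\<^sub>R x k) (\<Sum>k<n. laguerre_diff k t *\<^sub>R x k) < e" by simp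
  qed
qed

lemma continuous_on_laguerre_series:
  fixes x :: "nat \<Rightarrow> 'h::banach"
  assumes "summable (\<lambda>n. (norm (x n))\<^sup>2)"
  shows "continuous_on {0..b} (\<lambda>t. \<Sum>n. laguerre_diff n t *\<^sub>R x n)"
proof (rule uniform_limit_theorem[OF _ uniform_limit_laguerre_series[OF assms]])
  have "continuous_on {0..b} (laguerre_diff n)" for n
    by (rule DERIV_continuous_on) (rule DERIV_subset[OF DERIV_laguerre_diff'], simp)
  then show "\<forall>\<^sub>F N in sequentially. continuous_on {0..b} (\<lambda>t. \<Sum>n<N. laguerre_diff n t *\<^sub>R x n)"
    by (intro always_eventually allI continuous_intros)
qed simp

text \<open>With \<open>c\<^sub>n = a\<^sub>n - a\<^sub>n\<^sub>-\<^sub>1\<close> for \<open>a\<^sub>n = laguerre_diff n\<close>, the derivative of \<open>c\<^sub>n\<close> is \<open>- a\<^sub>n\<^sub>-\<^sub>1\<close>.\<close>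

lemma has_vector_derivative_laguerre_series:
  fixes x :: "nat \<Rightarrow> 'h::banach"
  assumes x: "summable (\<lambda>n. (norm (x n))\<^sup>2)" and t: "0 < t"
  shows "((\<lambda>t. (\<Sum>n. laguerre_diff n t *\<^sub>R x n) - (\<Sum>n. laguerre_diff n t *\<^sub>R x (Suc n)))
     has_vector_derivative - (\<Sum>n. laguerre_diff n t *\<^sub>R x (Suc n))) (at t)"
proof -
  define b where "b = t + 1"
  define c where "c n t = (case n of 0 \<Rightarrow> 1 | Suc m \<Rightarrow> laguerre_diff (Suc m) t - laguerre_diff m t)" for n t
  define d where "d n t = (case n of 0 \<Rightarrow> 0 | Suc m \<Rightarrow> - laguerre_diff m t)" for n t
  have cd: "((\<lambda>t. c n t *\<^sub>R x n) has_derivative (\<lambda>h. h *\<^sub>R d n s *\<^sub>R x n)) (at s within S)" for n s S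
  proof -
    have "(c n has_real_derivative d n s) (at s)"
    proof (cases n)
      case 0
      then show ?thesis by (simp add: c_def[abs_def] d_def)
    next
      case (Suc m)
      have "((\<lambda>t. laguerre_diff (Suc m) t - laguerre_diff m t) has_real_derivative - laguerre_diff m s) (at s)"
        using DERIV_diff[OF DERIV_laguerre_diff'[of "Suc m" s] DERIV_laguerre_diff'[of m s]]
        by (rule DERIV_cong) (cases m, auto)
      then show ?thesis by (simp add: c_def[abs_def] d_def Suc)
    qed
    then have "(c n has_real_derivative d n s) (at s within S)"
      by (rule DERIV_subset) simp
    from has_vector_derivative_scaleR[OF this has_vector_derivative_const[of "x n"]]
    show ?thesis by (simp add: has_vector_derivative_def)
  qed
  have xs: "summable (\<lambda>n. (norm (x (Suc n)))\<^sup>2)"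
    using x by (subst summable_Suc_iff)
  have "\<exists>g. \<forall>s\<in>{0..b}. (\<lambda>n. c n s *\<^sub>R x n) sums g s \<and>
     (g has_derivative (\<lambda>h. h *\<^sub>R - (\<Sum>n. laguerre_diff n s *\<^sub>R x (Suc n)))) (at s within {0..b})"
  proof (rule has_derivative_series[where x=0])
    show "((\<lambda>t. c n t *\<^sub>R x n) has_derivative (\<lambda>h. h *\<^sub>R d n s *\<^sub>R x n)) (at s within {0..b})" for n s
      by (rule cd)
    show "0 \<in> {0..b}" using t by (simp add: b_def)
    \<comment> \<open>Convergence at one point anchors the termwise differentiation. At time 0 only
      \<open>laguerre_diff 0\<close> survives, which leaves \<open>c 0 = 1\<close> and
      \<open>c 1 = -1\<close>.\<close>
    show "(\<lambda>n. c n 0 *\<^sub>R x n) sums (x 0 - x 1)"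
    proof -
      have "(\<lambda>n. c n 0 *\<^sub>R x n) sums (\<Sum>n<2. c n 0 *\<^sub>R x n)"
        by (rule sums_finite) (auto simp: c_def laguerre_diff_at_0 simp del: laguerre_diff_simps split: nat.splits)
      then show ?thesis by (simp add: c_def numeral_2_eq_2 laguerre_diff_at_0 del: laguerre_diff_simps)
    qed
  next
    fix e :: real assume "e > 0"
    from uniform_limitD[OF uniform_limit_laguerre_series[OF xs, of b] this]
    have "\<forall>\<^sub>F N in sequentially. \<forall>s\<in>{0..b}. dist (\<Sum>n<N. laguerre_diff n s *\<^sub>R x (Suc n)) (\<Sum>n. laguerre_diff n s *\<^sub>R x (Suc n)) < e" .
    \<comment> \<open>Since \<open>d 0\<close> vanishes, the first \<open>N\<close> derivatives make
      up only \<open>N - 1\<close> terms of the shifted series.\<close>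
    then have "\<forall>\<^sub>F N in sequentially. \<forall>s\<in>{0..b}. dist (\<Sum>n<N - 1. laguerre_diff n s *\<^sub>R x (Suc n)) (\<Sum>n. laguerre_diff n s *\<^sub>R x (Suc n)) < e"
      by (subst eventually_sequentially_Suc[symmetric]) simp
    then show "\<forall>\<^sub>F N in sequentially. \<forall>s\<in>{0..b}. \<forall>h. norm ((\<Sum>n<N. h *\<^sub>R d n s *\<^sub>R x n) -
        h *\<^sub>R - (\<Sum>n. laguerre_diff n s *\<^sub>R x (Suc n))) \<le> e * norm h"
    proof (rule eventually_mono, intro ballI allI)
      fix N s and h :: real
      assume *: "\<forall>s\<in>{0..b}. dist (\<Sum>n<N - 1. laguerre_diff n s *\<^sub>R x (Suc n)) (\<Sum>n. laguerre_diff n s *\<^sub>R x (Suc n)) < e"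
        and s: "s \<in> {0..b}"
      have "(\<Sum>n<N. d n s *\<^sub>R x n) = - (\<Sum>n<N - 1. laguerre_diff n s *\<^sub>R x (Suc n))"
      proof (cases N)
        case (Suc k)
        then show ?thesis by (simp add: sum.lessThan_Suc_shift d_def sum_negf del: sum.lessThan_Suc)
      qed simp
      then have "(\<Sum>n<N. h *\<^sub>R d n s *\<^sub>R x n) - h *\<^sub>R - (\<Sum>n. laguerre_diff n s *\<^sub>R x (Suc n)) =
        - h *\<^sub>R ((\<Sum>n<N - 1. laguerre_diff n s *\<^sub>R x (Suc n)) - (\<Sum>n. laguerre_diff n s *\<^sub>R x (Suc n)))"
        by (simp add: scaleR_right.sum[symmetric] scaleR_right_diff_distrib del: scaleR_scaleR)
      then show "norm ((\<Sum>n<N. h *\<^sub>R d n s *\<^sub>R x n) -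
        h *\<^sub>R - (\<Sum>n. laguerre_diff n s *\<^sub>R x (Suc n))) \<le> e * norm h"
        using bspec[OF * s] by (simp add: dist_norm mult.commute[of e] mult_left_mono)
    qed
  qed simp
  then obtain g where g: "\<And>s. s \<in> {0..b} \<Longrightarrow> (\<lambda>n. c n s *\<^sub>R x n) sums g s"
    "\<And>s. s \<in> {0..b} \<Longrightarrow> (g has_vector_derivative - (\<Sum>n. laguerre_diff n s *\<^sub>R x (Suc n))) (at s within {0..b})"
    unfolding has_vector_derivative_def by blast
  have geq: "g s = (\<Sum>n. laguerre_diff n s *\<^sub>R x n) - (\<Sum>n. laguerre_diff n s *\<^sub>R x (Suc n))"
    if s: "s \<in> {0..b}" for s
  proof -
    have l: "summable (\<lambda>n. (laguerre_diff n s)\<^sup>2)" using s by (intro summable_laguerre_diff_squares) simp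
    have 1: "(\<lambda>n. laguerre_diff n s *\<^sub>R x n) sums (\<Sum>n. laguerre_diff n s *\<^sub>R x n)"
      by (intro summable_sums summable_scaleR_l2 l x)
    have 2: "(\<lambda>n. laguerre_diff n s *\<^sub>R x (Suc n)) sums (\<Sum>n. laguerre_diff n s *\<^sub>R x (Suc n))"
      by (intro summable_sums summable_scaleR_l2 l xs)
    have "(\<lambda>n. laguerre_diff (Suc n) s *\<^sub>R x (Suc n)) sums ((\<Sum>n. laguerre_diff n s *\<^sub>R x n) - x 0)"
      using sums_Suc_iff[of "\<lambda>n. laguerre_diff n s *\<^sub>R x n" "(\<Sum>n. laguerre_diff n s *\<^sub>R x n) - x 0"] 1
      by (simp del: laguerre_diff_simps(2))
    from sums_diff[OF this 2]
    have "(\<lambda>n. c (Suc n) s *\<^sub>R x (Suc n)) sums ((\<Sum>n. laguerre_diff n s *\<^sub>R x n) - x 0 - (\<Sum>n. laguerre_diff n s *\<^sub>R x (Suc n)))"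
      by (simp add: c_def scaleR_left_diff_distrib)
    then have "(\<lambda>n. c n s *\<^sub>R x n) sums ((\<Sum>n. laguerre_diff n s *\<^sub>R x n) - (\<Sum>n. laguerre_diff n s *\<^sub>R x (Suc n)))"
      by (subst (asm) sums_Suc_iff) (simp add: c_def)
    with g(1)[OF s] show ?thesis by (rule sums_unique2)
  qed
  have "((\<lambda>t. (\<Sum>n. laguerre_diff n t *\<^sub>R x n) - (\<Sum>n. laguerre_diff n t *\<^sub>R x (Suc n)))
     has_vector_derivative - (\<Sum>n. laguerre_diff n t *\<^sub>R x (Suc n))) (at t within {0..b})"
    by (rule has_vector_derivative_transform[OF _ _ g(2)]) (use t geq in \<open>auto simp: b_def\<close>)
  moreover have "at t within {0..b} = at t"
    by (rule at_within_interior) (use t in \<open>simp add: b_def\<close>)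
  ultimately show ?thesis by simp
qed

section \<open>The semigroup of a closed symmetric form\<close>

lemma has_vector_derivative_imp_tendsto:
  assumes "(f has_vector_derivative D) (at x within S)"
  shows "((\<lambda>y. (f y - f x) /\<^sub>R (y - x)) \<longlongrightarrow> D) (at x within S)"
proof -
  have "((\<lambda>y. norm ((f y - f x) - (y - x) *\<^sub>R D) / norm (y - x)) \<longlongrightarrow> 0) (at x within S)"
    using assms unfolding has_vector_derivative_def has_derivative_iff_norm by blast
  then have "((\<lambda>y. norm ((f y - f x) /\<^sub>R (y - x) - D)) \<longlongrightarrow> 0) (at x within S)"
  proof (rule Lim_transform_eventually)
    show "\<forall>\<^sub>F y in at x within S. norm ((f y - f x) - (y - x) *\<^sub>R D) / norm (y - x) = norm ((f y - f x) /\<^sub>R (y - x) - D)"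
      unfolding eventually_at_filter
    proof (intro always_eventually allI impI)
      fix y assume "y \<noteq> x"
      then have "(f y - f x) - (y - x) *\<^sub>R D = (y - x) *\<^sub>R ((f y - f x) /\<^sub>R (y - x) - D)"
        by (simp add: scaleR_right_diff_distrib)
      then show "norm ((f y - f x) - (y - x) *\<^sub>R D) / norm (y - x) = norm ((f y - f x) /\<^sub>R (y - x) - D)"
        using \<open>y \<noteq> x\<close> by (simp only: norm_scaleR) simp
    qed
  qed
  then show ?thesis
    by (rule LIM_zero_cancel[OF tendsto_norm_zero_cancel])
qed

text \<open>The first-order condition at a minimiser, from a single test point instead of a
  derivative.\<close>

lemma quadratic_nonneg_imp_linear_zero:
  fixes a b :: real
  assumes "\<And>s. 0 \<le> b * s + a * s\<^sup>2"
  shows "b = 0"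
proof (rule ccontr)
  assume "b \<noteq> 0"
  \<comment> \<open>A step against the slope. The denominator exceeds \<open>a\<close> and is
    positive for either sign of \<open>a\<close>, so the linear term dominates the quadratic
    one.\<close>
  define s where "s = - b / (1 + \<bar>a\<bar>)"
  have "b * s + a * s\<^sup>2 = b\<^sup>2 / (1 + \<bar>a\<bar>) * (a / (1 + \<bar>a\<bar>) - 1)"
    unfolding s_def by (simp add: add_pos_nonneg power2_eq_square divide_simps) (simp add: algebra_simps)
  also have "\<dots> < 0"
  proof (rule mult_pos_neg)
    show "0 < b\<^sup>2 / (1 + \<bar>a\<bar>)" using \<open>b \<noteq> 0\<close> by (simp add: add_pos_nonneg)
    have "a < 1 + \<bar>a\<bar>" by linarith
    then show "a / (1 + \<bar>a\<bar>) - 1 < 0" by (simp add: add_pos_nonneg)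
  qed
  finally show False using assms[of s] by linarith
qed

text \<open>Closedness is put as lower semicontinuity along sequences of convergent energy, which is
  what a minimising sequence provides and what Fatou's lemma delivers. Symmetry and nonnegativity
  are asked for off \<open>D\<close> too: the energy form has both there, as its integral takes the
  value 0 where the integrand is not integrable.\<close>

locale closed_form =
  fixes D :: "'h::{real_inner,banach} set" and E :: "'h \<Rightarrow> 'h \<Rightarrow> real"
  assumes subspace_D: "subspace D"
    and E_add_left: "x \<in> D \<Longrightarrow> y \<in> D \<Longrightarrow> z \<in> D \<Longrightarrow> E (x + y) z = E x z + E y z"
    and E_scale_left: "x \<in> D \<Longrightarrow> z \<in> D \<Longrightarrow> E (r *\<^sub>R x) z = r * E x z"
    and E_commute: "E x y = E y x"
    and E_nonneg: "0 \<le> E x x"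
    and closed: "(\<And>n. X n \<in> D) \<Longrightarrow> X \<longlonglongrightarrow> x \<Longrightarrow> (\<lambda>n. E (X n) (X n)) \<longlonglongrightarrow> e \<Longrightarrow> x \<in> D \<and> E x x \<le> e"
begin

lemma D_add: "x \<in> D \<Longrightarrow> y \<in> D \<Longrightarrow> x + y \<in> D"
  and D_diff: "x \<in> D \<Longrightarrow> y \<in> D \<Longrightarrow> x - y \<in> D"
  and D_scale: "x \<in> D \<Longrightarrow> r *\<^sub>R x \<in> D"
  and D_0: "0 \<in> D"
  using subspace_D by (auto intro: subspace_add subspace_diff subspace_scale subspace_0)

lemma E_diff_left: "x \<in> D \<Longrightarrow> y \<in> D \<Longrightarrow> z \<in> D \<Longrightarrow> E (x - y) z = E x z - E y z"
  using E_add_left[of x "(- 1) *\<^sub>R y" z] E_scale_left[of y z "- 1"] D_scale[of y "-1"] by simp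

lemma E_add_right: "x \<in> D \<Longrightarrow> y \<in> D \<Longrightarrow> z \<in> D \<Longrightarrow> E z (x + y) = E z x + E z y"
  and E_diff_right: "x \<in> D \<Longrightarrow> y \<in> D \<Longrightarrow> z \<in> D \<Longrightarrow> E z (x - y) = E z x - E z y"
  and E_scale_right: "x \<in> D \<Longrightarrow> z \<in> D \<Longrightarrow> E z (r *\<^sub>R x) = r * E z x"
  using E_add_left[of x y z] E_diff_left[of x y z] E_scale_left[of x z r] by (simp_all add: E_commute)

lemmas E_simps = E_add_left E_add_right E_diff_left E_diff_right E_scale_left E_scale_right
  D_add D_diff D_scale

section \<open>The operator of the form and its resolvent\<close>

definition generates :: "'h \<Rightarrow> 'h \<Rightarrow> bool" where
  "generates x y \<longleftrightarrow> x \<in> D \<and> (\<forall>z\<in>D. y \<bullet> z = E x z)"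

text \<open>The point \<open>(1 + \<lambda> A)\<^sup>-\<^sup>1 f\<close> minimises \<open>\<parallel>g - f\<parallel>\<^sup>2 + \<lambda> E g g\<close>.\<close>

lemma resolvent_exists:
  assumes l: "0 < l"
  shows "\<exists>g\<in>D. \<forall>h\<in>D. g \<bullet> h + l * E g h = f \<bullet> h"
proof -
  define F where "F g = (norm (g - f))\<^sup>2 + l * E g g" for g
  define m where "m = Inf (F ` D)"
  have F0: "0 \<le> F g" for g using l E_nonneg by (simp add: F_def)
  have bdd: "bdd_below (F ` D)" by (rule bdd_belowI[of _ 0]) (use F0 in auto)
  have mF: "m \<le> F g" if "g \<in> D" for g
    unfolding m_def using that bdd by (intro cInf_lower) auto
  have "\<exists>g\<in>D. F g < m + inverse (real (Suc n))" for n
  proof -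
    have "Inf (F ` D) < m + inverse (real (Suc n))" by (simp add: m_def)
    then show ?thesis using bdd D_0 by (subst (asm) cInf_less_iff) auto
  qed
  then obtain G where G: "\<And>n. G n \<in> D" "\<And>n. F (G n) < m + inverse (real (Suc n))" by metis
  have Fm: "(\<lambda>n. F (G n)) \<longlonglongrightarrow> m"
  proof (rule real_tendsto_sandwich[of "\<lambda>_. m" _ _ "\<lambda>n. m + inverse (real (Suc n))"])
    show "(\<lambda>n. m + inverse (real (Suc n))) \<longlonglongrightarrow> m"
      using tendsto_add[OF tendsto_const LIMSEQ_inverse_real_of_nat, of m] by simp
    show "\<forall>\<^sub>F n in sequentially. F (G n) \<le> m + inverse (real (Suc n))"
      using G(2) less_imp_le by (intro always_eventually allI) blast
  qed (use mF G in \<open>auto intro!: always_eventually\<close>)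
  \<comment> \<open>The parallelogram law, for the norm and for the form at once: the midpoint of
    two near-minimisers cannot lie below the infimum, so they are close to each other.\<close>
  have par: "(norm (a - b))\<^sup>2 \<le> 2 * (F a - m) + 2 * (F b - m)" if "a \<in> D" "b \<in> D" for a b
  proof -
    have n: "(norm ((1/2) *\<^sub>R (a + b) - f))\<^sup>2 = (norm (a - f))\<^sup>2 / 2 + (norm (b - f))\<^sup>2 / 2 - (norm (a - b))\<^sup>2 / 4"
      by (simp add: power2_norm_eq_inner inner_simps inner_commute) (simp add: field_simps)
    have "E ((1/2) *\<^sub>R (a + b)) ((1/2) *\<^sub>R (a + b)) = E a a / 2 + E b b / 2 - E (a - b) (a - b) / 4"
      using that by (simp add: E_simps E_commute[of b a] del: scaleR_add_right) (simp add: field_simps)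
    then have "F ((1/2) *\<^sub>R (a + b)) = F a / 2 + F b / 2 - ((norm (a - b))\<^sup>2 + l * E (a - b) (a - b)) / 4"
      unfolding F_def n by (simp only:) (simp add: field_simps)
    moreover have "m \<le> F ((1/2) *\<^sub>R (a + b))" using that by (intro mF E_simps)
    moreover have "0 \<le> l * E (a - b) (a - b)" using l E_nonneg by simp
    ultimately show ?thesis by (simp add: field_simps)
  qed
  have "Cauchy G"
  proof (rule metric_CauchyI)
    fix e :: real assume "0 < e"
    then have "\<forall>\<^sub>F n in sequentially. F (G n) < m + e\<^sup>2 / 4"
      by (intro order_tendstoD(2)[OF Fm]) simp
    then obtain N where N: "\<And>n. n \<ge> N \<Longrightarrow> F (G n) < m + e\<^sup>2 / 4"
      unfolding eventually_sequentially by auto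
    have "dist (G i) (G j) < e" if "i \<ge> N" "j \<ge> N" for i j
    proof -
      have "(norm (G i - G j))\<^sup>2 < e\<^sup>2"
        using par[OF G(1)[of i] G(1)[of j]] N[OF that(1)] N[OF that(2)] by (simp add: field_simps)
      then show ?thesis
        using \<open>0 < e\<close> by (simp add: dist_norm power2_less_imp_less)
    qed
    then show "\<exists>M. \<forall>i\<ge>M. \<forall>j\<ge>M. dist (G i) (G j) < e" by blast
  qed
  then obtain g where g: "G \<longlonglongrightarrow> g" using convergent_eq_Cauchy by blast
  \<comment> \<open>The energies converge because both \<open>F\<close> and the distance to
    \<open>f\<close> do along the sequence; \<open>closed\<close> asks for such a limit.\<close>
  have "(\<lambda>n. (F (G n) - (norm (G n - f))\<^sup>2) / l) \<longlonglongrightarrow> (m - (norm (g - f))\<^sup>2) / l"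
    using l by (intro tendsto_intros Fm g) simp
  then have "(\<lambda>n. E (G n) (G n)) \<longlonglongrightarrow> (m - (norm (g - f))\<^sup>2) / l"
    using l by (simp add: F_def)
  from closed[OF G(1) g this] have gD: "g \<in> D" and "E g g \<le> (m - (norm (g - f))\<^sup>2) / l" by auto
  then have gm: "F g \<le> m" using l by (simp add: F_def field_simps)
  have "g \<bullet> h + l * E g h = f \<bullet> h" if h: "h \<in> D" for h
  proof -
    \<comment> \<open>The variation of \<open>F\<close> at its minimiser in direction
      \<open>h\<close> is a nonnegative quadratic in \<open>s\<close>; its linear coefficient is the
      equation sought.\<close>
    have "0 \<le> (2 * ((g - f) \<bullet> h + l * E g h)) * s + ((norm h)\<^sup>2 + l * E h h) * s\<^sup>2" for s
    proof -
      have "F (g + s *\<^sub>R h) = F g + (2 * ((g - f) \<bullet> h + l * E g h)) * s + ((norm h)\<^sup>2 + l * E h h) * s\<^sup>2"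
        using gD h unfolding F_def power2_norm_eq_inner power2_eq_square[of s]
        by (simp add: E_simps inner_simps E_commute[of h g] inner_commute algebra_simps)
      moreover have "m \<le> F (g + s *\<^sub>R h)" using gD h by (intro mF E_simps)
      ultimately show ?thesis using gm by linarith
    qed
    from quadratic_nonneg_imp_linear_zero[OF this] show ?thesis by (simp add: inner_diff_left)
  qed
  with gD show ?thesis by blast
qed

definition resolvent :: "real \<Rightarrow> 'h \<Rightarrow> 'h" where
  "resolvent l f = (SOME g. g \<in> D \<and> (\<forall>h\<in>D. g \<bullet> h + l * E g h = f \<bullet> h))"

lemma resolvent_in_D: "0 < l \<Longrightarrow> resolvent l f \<in> D"
  and resolvent_eq: "0 < l \<Longrightarrow> h \<in> D \<Longrightarrow> resolvent l f \<bullet> h + l * E (resolvent l f) h = f \<bullet> h"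
  using someI_ex[of "\<lambda>g. g \<in> D \<and> (\<forall>h\<in>D. g \<bullet> h + l * E g h = f \<bullet> h)"] resolvent_exists[of l f]
  unfolding resolvent_def by blast+

lemma resolvent_unique:
  assumes l: "0 < l" and g: "g \<in> D" "\<And>h. h \<in> D \<Longrightarrow> g \<bullet> h + l * E g h = f \<bullet> h"
  shows "resolvent l f = g"
proof -
  let ?d = "resolvent l f - g"
  have d: "?d \<in> D" by (intro D_diff resolvent_in_D l g)
  have "?d \<bullet> ?d + l * E ?d ?d = 0"
    using resolvent_eq[OF l d, of f] g(2)[OF d] resolvent_in_D[OF l, of f] d g(1)
    by (simp add: inner_diff_left E_diff_left right_diff_distrib)
  moreover have "0 \<le> l * E ?d ?d" using l E_nonneg by simp
  ultimately have "?d \<bullet> ?d = 0" using inner_ge_zero[of ?d] by linarith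
  then show ?thesis by simp
qed

lemma resolvent_add: "0 < l \<Longrightarrow> resolvent l (f + g) = resolvent l f + resolvent l g"
proof (rule resolvent_unique)
  fix h assume l: "0 < l" and h: "h \<in> D"
  have "(resolvent l f + resolvent l g) \<bullet> h + l * E (resolvent l f + resolvent l g) h =
    (resolvent l f \<bullet> h + l * E (resolvent l f) h) + (resolvent l g \<bullet> h + l * E (resolvent l g) h)"
    using resolvent_in_D[OF l] h by (simp add: E_simps inner_add_left algebra_simps)
  then show "(resolvent l f + resolvent l g) \<bullet> h + l * E (resolvent l f + resolvent l g) h = (f + g) \<bullet> h"
    by (simp only: resolvent_eq[OF l h] inner_add_left)
qed (auto intro: D_add resolvent_in_D)

lemma resolvent_scale: "0 < l \<Longrightarrow> resolvent l (r *\<^sub>R f) = r *\<^sub>R resolvent l f"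
proof (rule resolvent_unique)
  fix h assume l: "0 < l" and h: "h \<in> D"
  have "r * (resolvent l f \<bullet> h + l * E (resolvent l f) h) = r * (f \<bullet> h)"
    by (simp only: resolvent_eq[OF l h])
  then show "(r *\<^sub>R resolvent l f) \<bullet> h + l * E (r *\<^sub>R resolvent l f) h = (r *\<^sub>R f) \<bullet> h"
    using resolvent_in_D[OF l] h by (simp add: E_simps algebra_simps)
qed (auto intro: D_scale resolvent_in_D)

text \<open>Testing the resolvent equation with \<open>g = resolvent l f\<close> itself gives
  \<open>f \<bullet> g - g \<bullet> g = l * E g g\<close>, and the gap in the inequality is twice
  this quantity.\<close>

lemma norm_resolvent_sum_le:
  assumes l: "0 < l"
  shows "(norm (resolvent l f))\<^sup>2 + (norm (f - resolvent l f))\<^sup>2 \<le> (norm f)\<^sup>2"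
proof -
  let ?g = "resolvent l f"
  have "?g \<bullet> ?g + l * E ?g ?g = f \<bullet> ?g" by (intro resolvent_eq l resolvent_in_D)
  moreover have "0 \<le> l * E ?g ?g" using l E_nonneg by simp
  ultimately show ?thesis
    by (simp add: power2_norm_eq_inner inner_simps inner_commute)
qed

lemma norm_resolvent_le: "0 < l \<Longrightarrow> norm (resolvent l f) \<le> norm f"
proof -
  assume l: "0 < l"
  have "(norm (resolvent l f))\<^sup>2 \<le> (norm f)\<^sup>2"
    using norm_resolvent_sum_le[OF l, of f] zero_le_power2[of "norm (f - resolvent l f)"] by linarith
  then show ?thesis by (rule power2_le_imp_le) simp
qed

lemma bounded_linear_resolvent: "0 < l \<Longrightarrow> bounded_linear (resolvent l)"
  by (rule bounded_linear_intro[of _ 1]) (auto simp: resolvent_add resolvent_scale norm_resolvent_le)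

lemma generates_resolvent: "0 < l \<Longrightarrow> generates (resolvent l f) ((f - resolvent l f) /\<^sub>R l)"
  unfolding generates_def using resolvent_eq[of l _ f]
  by (auto simp: resolvent_in_D inner_diff_left field_simps)

text \<open>Testing with \<open>f - g\<close> this time turns the squared distance into
  \<open>l * (E g f - E g g)\<close>; its sign and \<open>0 \<le> E (f - g) (f - g)\<close> give
  both bounds. The second is a rate for the convergence of the resolvent to the identity as
  \<open>l\<close> tends to 0.\<close>

lemma resolvent_energy:
  assumes l: "0 < l" and f: "f \<in> D"
  shows "E (resolvent l f) (resolvent l f) \<le> E f f"
    and "(norm (f - resolvent l f))\<^sup>2 \<le> l * E f f"
proof -
  let ?g = "resolvent l f"
  have g: "?g \<in> D" by (rule resolvent_in_D[OF l])
  have 1: "(norm (f - ?g))\<^sup>2 = l * (E ?g f - E ?g ?g)"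
    using resolvent_eq[OF l D_diff[OF f g], of f] f g
    by (simp add: E_simps power2_norm_eq_inner inner_simps algebra_simps)
  then have "0 \<le> l * (E ?g f - E ?g ?g)" by (metis zero_le_power2)
  then have 2: "E ?g ?g \<le> E ?g f" using l by (simp add: zero_le_mult_iff)
  have "0 \<le> E (f - ?g) (f - ?g)" by (rule E_nonneg)
  then have 3: "2 * E ?g f \<le> E ?g ?g + E f f" using f g by (simp add: E_simps E_commute[of f ?g])
  from 2 3 show "E ?g ?g \<le> E f f" by linarith
  have "E ?g f - E ?g ?g \<le> E f f" using 2 3 E_nonneg[of ?g] by linarith
  then show "(norm (f - ?g))\<^sup>2 \<le> l * E f f" unfolding 1 using l by simp
qed

text \<open>Continuity of the derivative \<open>V\<close> and the equation itself are asked for down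
  to time 0, so that energy comparisons can start at the data. Carrying \<open>V\<close> along
  expresses the energy as \<open>- (V t \<bullet> U t)\<close>, an inner product of continuous
  functions.\<close>

definition classical_solution :: "(real \<Rightarrow> 'h) \<Rightarrow> (real \<Rightarrow> 'h) \<Rightarrow> bool" where
  "classical_solution U V \<longleftrightarrow> continuous_on {0..} U \<and> continuous_on {0..} V \<and>
     (\<forall>t>0. (U has_vector_derivative V t) (at t)) \<and> (\<forall>t\<ge>0. generates (U t) (- V t))"

text \<open>In terms of \<open>S = 1 - R\<close>, the exponential is
  \<open>exp (- t A) = exp (- (t / l) S (1 - S)\<^sup>-\<^sup>1)\<close>, and \<open>exp (- t y / (1 - y))\<close> is the generating
  function of \<open>laguerre_diff\<close>. The powers \<open>S\<^sup>n R f\<close> are square summable, as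
  \<open>\<parallel>R g\<parallel>\<^sup>2 \<le> \<parallel>g\<parallel>\<^sup>2 - \<parallel>S g\<parallel>\<^sup>2\<close> telescopes.\<close>

lemma classical_solution_exists:
  assumes l: "0 < l"
  shows "\<exists>U V. classical_solution U V \<and> U 0 = resolvent l (resolvent l f)"
proof -
  define R where "R = resolvent l"
  define S where "S g = g - R g" for g
  define x where "x n = (S ^^ n) (R f)" for n
  interpret R: bounded_linear R unfolding R_def by (rule bounded_linear_resolvent[OF l])
  interpret S: bounded_linear S
    unfolding S_def[abs_def] by (intro bounded_linear_sub bounded_linear_ident R.bounded_linear)
  have SR: "S (R g) = R (S g)" for g by (simp add: S_def R.diff)
  have x_eq: "x n = R ((S ^^ n) f)" for n
    by (induction n) (auto simp: x_def SR)
  have x: "summable (\<lambda>n. (norm (x n))\<^sup>2)"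
  proof (rule summableI_nonneg_bounded)
    fix N
    have "(\<Sum>n<N. (norm (x n))\<^sup>2) \<le> (norm f)\<^sup>2 - (norm ((S ^^ N) f))\<^sup>2"
    proof (induction N)
      case (Suc N)
      then show ?case
        using norm_resolvent_sum_le[OF l, of "(S ^^ N) f"] by (simp add: x_eq S_def[of "(S ^^ N) f"] R_def)
    qed simp
    then show "(\<Sum>n<N. (norm (x n))\<^sup>2) \<le> (norm f)\<^sup>2"
      using zero_le_power2[of "norm ((S ^^ N) f)"] by linarith
  qed simp
  then have xs: "summable (\<lambda>n. (norm (x (Suc n)))\<^sup>2)" by (subst summable_Suc_iff)
  define w where "w t = (\<Sum>n. laguerre_diff n t *\<^sub>R x n)" for t
  have Sw: "S (w t) = (\<Sum>n. laguerre_diff n t *\<^sub>R x (Suc n))" if "0 \<le> t" for t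
  proof -
    have "(\<lambda>n. laguerre_diff n t *\<^sub>R x n) sums w t"
      unfolding w_def by (intro summable_sums summable_scaleR_l2 summable_laguerre_diff_squares x that)
    from S.sums[OF this] show ?thesis by (simp add: S.scaleR x_def sums_iff)
  qed
  \<comment> \<open>This turns \<open>R (w t)\<close> into the difference of two series for which
    the derivative is known.\<close>
  have Rw: "R g = g - S g" for g by (simp add: S_def)
  have wc: "continuous_on {0..} w"
  proof (rule continuous_on_eq_continuous_within[THEN iffD2], rule ballI)
    fix t :: real assume t: "t \<in> {0..}"
    have "continuous (at t within {0..t + 1}) w"
      using continuous_on_laguerre_series[OF x, of "t + 1"] t
      unfolding w_def[abs_def] continuous_on_eq_continuous_within by auto
    moreover have "at t within {0..t + 1} = at t within {0..}"
      by (rule at_within_nhd[of _ "{..<t + 1}"]) auto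
    ultimately show "continuous (at t within {0..}) w" by simp
  qed
  \<comment> \<open>The outer \<open>R\<close> lands in the domain of the operator, where
    \<open>A R = S / l\<close>. The factor \<open>1 / l\<close> explains the rescaled time.\<close>
  define U where "U t = R (w (t / l))" for t
  define V where "V t = (- 1 / l) *\<^sub>R S (w (t / l))" for t
  have wcl: "continuous_on {0..} (\<lambda>t. w (t / l))"
    by (rule continuous_on_compose2[OF wc]) (use l in \<open>auto intro!: continuous_intros\<close>)
  have "continuous_on {0..} U" "continuous_on {0..} V"
    unfolding U_def V_def by (intro continuous_intros R.continuous_on S.continuous_on wcl)+
  moreover have "(U has_vector_derivative V t) (at t)" if t: "0 < t" for t
  proof -
    have "((\<lambda>t. (\<Sum>n. laguerre_diff n t *\<^sub>R x n) - (\<Sum>n. laguerre_diff n t *\<^sub>R x (Suc n)))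
       has_vector_derivative - (\<Sum>n. laguerre_diff n (t / l) *\<^sub>R x (Suc n))) (at (t / l))"
      using t l by (intro has_vector_derivative_laguerre_series x) simp
    then have "((\<lambda>t. R (w t)) has_vector_derivative - S (w (t / l))) (at (t / l))"
      unfolding Sw[OF order_less_imp_le[OF divide_pos_pos[OF t l]]]
      by (rule has_vector_derivative_transform_within_open[of _ _ _ "{0<..}"])
        (use t l Sw in \<open>auto simp: Rw w_def\<close>)
    moreover have "((\<lambda>t. t / l) has_vector_derivative 1 / l) (at t)"
      using l by (auto intro!: derivative_eq_intros simp: has_real_derivative_iff_has_vector_derivative[symmetric])
    ultimately show ?thesis
      using vector_diff_chain_at[of "\<lambda>t. t / l" "1 / l" t "\<lambda>t. R (w t)" "- S (w (t / l))"]
      by (simp add: U_def[abs_def] V_def o_def)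
  qed
  moreover have "generates (U t) (- V t)" for t
    using generates_resolvent[OF l, of "w (t / l)"] by (simp add: U_def V_def S_def R_def divide_inverse)
  moreover have "U 0 = resolvent l (resolvent l f)"
  proof -
    have "(\<lambda>n. laguerre_diff n 0 *\<^sub>R x n) sums (\<Sum>n<1. laguerre_diff n 0 *\<^sub>R x n)"
      by (rule sums_finite) (auto simp: laguerre_diff_at_0 simp del: laguerre_diff_simps)
    then have "w 0 = R f" by (simp add: w_def sums_iff x_def)
    then show ?thesis by (simp add: U_def R_def)
  qed
  ultimately show ?thesis unfolding classical_solution_def by blast
qed

section \<open>Monotonicity, energy decay and symmetry along a solution\<close>

context
  fixes U V assumes UV: "classical_solution U V"
begin

lemma solution_D: "0 \<le> t \<Longrightarrow> U t \<in> D"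
  and solution_E: "0 \<le> t \<Longrightarrow> z \<in> D \<Longrightarrow> E (U t) z = - (V t \<bullet> z)"
  and solution_deriv: "0 < t \<Longrightarrow> (U has_vector_derivative V t) (at t)"
  and solution_continuous: "continuous_on {0..} U" "continuous_on {0..} V"
  using UV by (auto simp: classical_solution_def generates_def)

lemma solution_energy_eq: "0 \<le> t \<Longrightarrow> E (U t) (U t) = - (V t \<bullet> U t)"
  by (simp add: solution_E solution_D)

lemma solution_energy_continuous: "continuous_on {0..} (\<lambda>t. E (U t) (U t))"
proof -
  have "continuous_on {0..} (\<lambda>t. - (V t \<bullet> U t))" by (intro continuous_intros solution_continuous)
  then show ?thesis by (rule continuous_on_eq) (simp add: solution_energy_eq)
qed

lemma DERIV_solution_inner:
  assumes "0 < t" "0 < s"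
  shows "((\<lambda>r. U (t + r) \<bullet> U (s - r)) has_real_derivative V t \<bullet> U s - U t \<bullet> V s) (at 0)"
proof -
  have "((\<lambda>r. t + r) has_vector_derivative 1) (at 0)" "((\<lambda>r. s - r) has_vector_derivative - 1) (at 0)"
    by (auto intro!: derivative_eq_intros simp flip: has_real_derivative_iff_has_vector_derivative)
  from vector_diff_chain_at[OF this(1), of U] vector_diff_chain_at[OF this(2), of U]
  have "((\<lambda>r. U (t + r)) has_vector_derivative V t) (at 0)"
    "((\<lambda>r. U (s - r)) has_vector_derivative - V s) (at 0)"
    using solution_deriv[OF assms(1)] solution_deriv[OF assms(2)] by (auto simp: o_def)
  from has_derivative_inner[OF this[unfolded has_vector_derivative_def]]
  show ?thesis
    unfolding has_field_derivative_def
    by (rule has_derivative_eq_rhs) (simp add: fun_eq_iff algebra_simps)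
qed

lemma DERIV_solution_norm:
  assumes t: "0 < t"
  shows "((\<lambda>t. (norm (U t))\<^sup>2) has_real_derivative 2 * (V t \<bullet> U t)) (at t)"
  using has_derivative_inner[OF solution_deriv[OF t, unfolded has_vector_derivative_def]
    solution_deriv[OF t, unfolded has_vector_derivative_def]]
  by (simp add: power2_norm_eq_inner has_field_derivative_def inner_commute mult_commute_abs algebra_simps)

text \<open>The product rule for \<open>- (V t \<bullet> U t)\<close> would involve a derivative of
  \<open>V\<close>. Symmetry of \<open>E\<close> gives
  \<open>V s \<bullet> U t = V t \<bullet> U s\<close>, which makes the energy increment equal to
  \<open>- ((U s - U t) \<bullet> (V s + V t))\<close>; continuity of \<open>V\<close> then
  suffices.\<close>

lemma DERIV_solution_energy:
  assumes t: "0 < t"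
  shows "((\<lambda>t. E (U t) (U t)) has_real_derivative - 2 * (norm (V t))\<^sup>2) (at t)"
  unfolding has_field_derivative_iff
proof (rule Lim_transform_eventually)
  have "continuous (at t within {0..}) V"
    using solution_continuous(2) t by (auto simp: continuous_on_eq_continuous_within)
  moreover have "at t within {0..} = at t"
    using t by (intro at_within_interior) (simp add: interior_real_atLeast)
  ultimately have V: "(V \<longlongrightarrow> V t) (at t)" by (simp add: continuous_within)
  have "((\<lambda>s. (U s - U t) /\<^sub>R (s - t)) \<longlongrightarrow> V t) (at t)"
    by (rule has_vector_derivative_imp_tendsto[OF solution_deriv[OF t]])
  then have "((\<lambda>s. - (((U s - U t) /\<^sub>R (s - t)) \<bullet> (V s + V t))) \<longlongrightarrow> - (V t \<bullet> (V t + V t))) (at t)"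
    by (intro tendsto_intros V)
  then show "((\<lambda>s. - (((U s - U t) /\<^sub>R (s - t)) \<bullet> (V s + V t))) \<longlongrightarrow> - 2 * (norm (V t))\<^sup>2) (at t)"
    by (simp add: power2_norm_eq_inner inner_simps)
  have "\<forall>\<^sub>F s in at t. 0 < s"
    using t by (intro order_tendstoD(1)[OF tendsto_ident_at]) auto
  then show "\<forall>\<^sub>F s in at t. - (((U s - U t) /\<^sub>R (s - t)) \<bullet> (V s + V t)) = (E (U s) (U s) - E (U t) (U t)) / (s - t)"
  proof eventually_elim
    case (elim s)
    have "E (U s) (U t) = E (U t) (U s)" by (rule E_commute)
    then have "V s \<bullet> U t = V t \<bullet> U s"
      using t elim by (simp add: solution_E solution_D)
    then show ?case
      using t elim by (simp add: solution_energy_eq inner_simps inner_commute divide_inverse algebra_simps)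
  qed
qed

text \<open>With \<open>k\<close> the Rayleigh quotient of the data, \<open>exp (2 k t) (E u u - k \<parallel>u\<parallel>\<^sup>2)\<close> has derivative
  \<open>- 2 exp (2 k t) \<parallel>A u - k u\<parallel>\<^sup>2\<close>, hence stays nonpositive.\<close>

lemma solution_norm_lower_bound:
  assumes t: "0 \<le> t" and nz: "U 0 \<noteq> 0"
  shows "(norm (U 0))\<^sup>2 * exp (- (2 * t * (E (U 0) (U 0) / (norm (U 0))\<^sup>2))) \<le> (norm (U t))\<^sup>2"
proof -
  define k where "k = E (U 0) (U 0) / (norm (U 0))\<^sup>2"
  define b where "b t = exp (2 * k * t) * (E (U t) (U t) - k * (norm (U t))\<^sup>2)" for t
  define g where "g t = exp (2 * k * t) * (norm (U t))\<^sup>2" for t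
  have cont: "continuous_on {0..s} U" "continuous_on {0..s} (\<lambda>t. E (U t) (U t))" for s
    using solution_continuous solution_energy_continuous by (auto intro: continuous_on_subset)
  have b0: "b s \<le> 0" if s: "0 \<le> s" for s
  proof -
    have "b s \<le> b 0"
    proof (rule DERIV_nonpos_imp_decreasing_open[OF s])
      fix x assume x: "0 < x" "x < s"
      have "(b has_real_derivative - (2 * exp (2 * k * x) * (norm (V x + k *\<^sub>R U x))\<^sup>2)) (at x)"
        unfolding b_def[abs_def]
        by (rule derivative_eq_intros DERIV_solution_energy DERIV_solution_norm x refl)+
          (use x in \<open>simp add: solution_energy_eq power2_norm_eq_inner inner_simps inner_commute algebra_simps\<close>)
      then show "\<exists>y. (b has_real_derivative y) (at x) \<and> y \<le> 0"
        by (intro exI conjI) auto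
    next
      show "continuous_on {0..s} b"
        unfolding b_def[abs_def] by (intro continuous_intros cont)
    qed
    also have "b 0 = 0" using nz by (simp add: b_def k_def)
    finally show ?thesis .
  qed
  have "g 0 \<le> g t"
  proof (rule DERIV_nonneg_imp_increasing_open[OF t])
    fix x assume x: "0 < x" "x < t"
    have "(g has_real_derivative - 2 * b x) (at x)"
      unfolding g_def[abs_def]
      by (rule derivative_eq_intros DERIV_solution_norm x refl)+
        (use x in \<open>simp add: b_def solution_energy_eq power2_norm_eq_inner inner_simps inner_commute algebra_simps\<close>)
    then show "\<exists>y. (g has_real_derivative y) (at x) \<and> 0 \<le> y"
      using b0[of x] x by (intro exI conjI) auto
  next
    show "continuous_on {0..t} g"
      unfolding g_def[abs_def] by (intro continuous_intros cont)
  qed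
  then show ?thesis
    by (simp add: g_def exp_minus field_simps flip: k_def)
qed

lemma solution_norm_le:
  assumes t: "0 \<le> t"
  shows "norm (U t) \<le> norm (U 0)"
proof -
  have "(norm (U t))\<^sup>2 \<le> (norm (U 0))\<^sup>2"
  proof (rule DERIV_nonpos_imp_decreasing_open[OF t])
    fix x assume x: "0 < x" "x < t"
    have "V x \<bullet> U x \<le> 0" using E_nonneg[of "U x"] x by (simp add: solution_energy_eq)
    then show "\<exists>y. ((\<lambda>t. (norm (U t))\<^sup>2) has_real_derivative y) (at x) \<and> y \<le> 0"
      using DERIV_solution_norm[OF x(1)] by (intro exI[of _ "2 * (V x \<bullet> U x)"]) auto
  next
    show "continuous_on {0..t} (\<lambda>t. (norm (U t))\<^sup>2)"
      using solution_continuous by (auto intro!: continuous_intros intro: continuous_on_subset)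
  qed
  then show ?thesis by (rule power2_le_imp_le) simp
qed

text \<open>Self-adjointness of the semigroup: shifting time from one factor to the other leaves the
  inner product constant, as \<open>E\<close> is symmetric. It converts a lower bound on a norm into
  one on a pairing with the data.\<close>

lemma solution_symmetry:
  assumes t: "0 < t"
  shows "U (2 * t) \<bullet> U 0 = (norm (U t))\<^sup>2"
proof -
  have "U (t + t) \<bullet> U (t - t) = U (t + 0) \<bullet> U (t - 0)"
  proof (rule DERIV_isconst_end[OF t])
    show "continuous_on {0..t} (\<lambda>s. U (t + s) \<bullet> U (t - s))"
      by (intro continuous_intros continuous_on_compose2[OF solution_continuous(1)]) (use t in auto)
    fix s assume s: "0 < s" "s < t"
    have "((\<lambda>r. U (t + s + r) \<bullet> U (t - s - r)) has_real_derivative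
       V (t + s) \<bullet> U (t - s) - U (t + s) \<bullet> V (t - s)) (at 0)"
      using s by (intro DERIV_solution_inner) auto
    moreover have "V (t + s) \<bullet> U (t - s) = V (t - s) \<bullet> U (t + s)"
      using E_commute[of "U (t + s)" "U (t - s)"] s by (simp add: solution_E solution_D)
    ultimately have "((\<lambda>r. U (t + (r + s)) \<bullet> U (t - (r + s))) has_real_derivative 0) (at 0)"
      by (simp add: inner_commute algebra_simps)
    then show "((\<lambda>s. U (t + s) \<bullet> U (t - s)) has_real_derivative 0) (at s)"
      using DERIV_shift[of "\<lambda>s. U (t + s) \<bullet> U (t - s)" 0 0 s] by simp
  qed
  then show ?thesis by (simp add: power2_norm_eq_inner)
qed

end

lemma classical_solution_near:
  assumes f: "f \<in> D" and e: "0 < e"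
  shows "\<exists>U V. classical_solution U V \<and> norm (f - U 0) \<le> e \<and> E (U 0) (U 0) \<le> E f f \<and> norm (U 0) \<le> norm f"
proof -
  \<comment> \<open>Chosen so that \<open>l * E f f\<close> is at most \<open>(e / 2)\<close>
    squared: each of the two resolvents moves \<open>f\<close> by at most \<open>e / 2\<close>. The
    added 1 covers zero energy.\<close>
  define l where "l = e\<^sup>2 / (4 * (E f f + 1))"
  have pos: "0 < E f f + 1" using E_nonneg[of f] by simp
  then have l: "0 < l" using e by (simp add: l_def)
  obtain U V where UV: "classical_solution U V" and U0: "U 0 = resolvent l (resolvent l f)"
    using classical_solution_exists[OF l] by blast
  let ?R = "resolvent l"
  have "(norm (f - ?R f))\<^sup>2 \<le> l * E f f" by (rule resolvent_energy[OF l f])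
  also have "\<dots> \<le> (e / 2)\<^sup>2"
    using pos e by (simp add: l_def power2_eq_square field_simps)
  finally have 1: "norm (f - ?R f) \<le> e / 2"
    by (rule power2_le_imp_le) (use e in simp)
  have "norm (f - U 0) = norm ((f - ?R f) + ?R (f - ?R f))"
    using bounded_linear.linear[OF bounded_linear_resolvent[OF l]] by (simp add: U0 linear_diff)
  also have "\<dots> \<le> norm (f - ?R f) + norm (f - ?R f)"
    by (intro norm_triangle_le add_left_mono norm_resolvent_le l)
  finally have "norm (f - U 0) \<le> e" using 1 by linarith
  moreover have "E (U 0) (U 0) \<le> E f f"
    unfolding U0 using resolvent_energy(1)[OF l] resolvent_in_D[OF l] f by (meson order_trans)
  moreover have "norm (U 0) \<le> norm f"
    unfolding U0 using norm_resolvent_le[OF l] by (meson order_trans)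
  ultimately show ?thesis using UV by blast
qed

theorem solution_inner_lower_bound:
  assumes f: "f \<in> D" "f \<noteq> 0" and t: "0 < t"
  shows "\<exists>U V. classical_solution U V \<and> norm (U 0) \<le> norm f \<and>
     (norm f)\<^sup>2 / 4 * exp (- (2 * t * E f f / (norm f)\<^sup>2)) \<le> U t \<bullet> f"
proof -
  define X where "X = exp (- (2 * t * E f f / (norm f)\<^sup>2))"
  have X: "0 < X" "X \<le> 1" using t E_nonneg[of f] by (auto simp: X_def)
  \<comment> \<open>Replacing \<open>f\<close> by \<open>U 0\<close> in the pairing costs
    \<open>norm f * e\<close>, half of the main term. As \<open>X \<le> 1\<close>, the same
    \<open>e\<close> keeps \<open>norm (U 0)\<close> above \<open>3/4\<close> of
    \<open>norm f\<close>, hence its square above one half.\<close>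
  define e where "e = norm f * X / 4"
  have e: "0 < e" "e \<le> norm f / 4" using X f by (auto simp: e_def)
  obtain U V where UV: "classical_solution U V" and U0: "norm (f - U 0) \<le> e" "E (U 0) (U 0) \<le> E f f"
    "norm (U 0) \<le> norm f"
    using classical_solution_near[OF f(1) e(1)] by blast
  have "norm f \<le> norm (U 0) + e"
    using U0(1) norm_triangle_ineq[of "f - U 0" "U 0"] by simp
  then have "3 / 4 * norm f \<le> norm (U 0)" using e by simp
  then have "(3 / 4 * norm f)\<^sup>2 \<le> (norm (U 0))\<^sup>2" by (intro power_mono) auto
  then have half: "(norm f)\<^sup>2 / 2 \<le> (norm (U 0))\<^sup>2"
    using zero_le_power2[of "norm f"] unfolding power_mult_distrib power_divide power2_eq_square[of "3::real"] power2_eq_square[of "4::real"] by linarith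
  have f2: "0 < (norm f)\<^sup>2" using f by simp
  have nz: "U 0 \<noteq> 0" using half f2 by auto
  \<comment> \<open>The perturbed data at most double the Rayleigh quotient. This is offset by using
    the norm bound at time \<open>t / 2\<close> only, so the exponent is the one in
    \<open>X\<close>.\<close>
  have "E (U 0) (U 0) / (norm (U 0))\<^sup>2 \<le> E f f / ((norm f)\<^sup>2 / 2)"
    using half f2 U0(2) E_nonneg by (intro frac_le) auto
  then have "t * (E (U 0) (U 0) / (norm (U 0))\<^sup>2) \<le> t * (E f f / ((norm f)\<^sup>2 / 2))"
    using t by (intro mult_left_mono) auto
  then have "X \<le> exp (- (2 * (t / 2) * (E (U 0) (U 0) / (norm (U 0))\<^sup>2)))"
    by (simp add: X_def algebra_simps)
  then have "(norm f)\<^sup>2 / 2 * X \<le> (norm (U 0))\<^sup>2 * exp (- (2 * (t / 2) * (E (U 0) (U 0) / (norm (U 0))\<^sup>2)))"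
    using half X by (intro mult_mono) auto
  also have "\<dots> \<le> (norm (U (t / 2)))\<^sup>2"
    using t by (intro solution_norm_lower_bound[OF UV _ nz]) auto
  also have "\<dots> = U t \<bullet> U 0"
    using solution_symmetry[OF UV, of "t / 2"] t by simp
  also have "\<dots> = U t \<bullet> f - U t \<bullet> (f - U 0)" by (simp add: inner_diff_right)
  also have "\<dots> \<le> U t \<bullet> f + norm f * e"
  proof -
    have "- (U t \<bullet> (f - U 0)) \<le> norm (U t) * norm (f - U 0)"
      using Cauchy_Schwarz_ineq2[of "U t" "f - U 0"] by linarith
    also have "\<dots> \<le> norm f * e"
      using solution_norm_le[OF UV, of t] t U0 by (intro mult_mono) auto
    finally show ?thesis by simp
  qed
  finally have "(norm f)\<^sup>2 / 4 * X \<le> U t \<bullet> f"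
    by (simp add: e_def power2_eq_square algebra_simps)
  then show ?thesis using UV U0(3) unfolding X_def by blast
qed

end

section \<open>The Hilbert space of square integrable functions\<close>

lemma Lp_space_2_iff: "f \<in> Lp_space 2 \<longleftrightarrow> f \<in> borel_measurable lebesgue \<and> integrable lebesgue (\<lambda>x. (f x)\<^sup>2)"
  by (simp add: Lp_space_def)

lemma Lp_norm_2_eq: "Lp_norm 2 f = sqrt (\<integral>x. (f x)\<^sup>2 \<partial>lebesgue)"
  by (simp add: Lp_norm_def powr_half_sqrt)

lemma Lp_space_2_measurable [measurable_dest]: "f \<in> Lp_space 2 \<Longrightarrow> f \<in> borel_measurable lebesgue"
  by (simp add: Lp_space_2_iff)

lemma Lp_space_2_mult_integrable:
  assumes [measurable]: "f \<in> Lp_space 2" "g \<in> Lp_space 2"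
  shows "integrable lebesgue (\<lambda>x. f x * g x)"
proof (rule Bochner_Integration.integrable_bound)
  show "integrable lebesgue (\<lambda>x. (f x)\<^sup>2 + (g x)\<^sup>2)"
    using assms by (simp add: Lp_space_2_iff)
  have "\<bar>a * b\<bar> \<le> a\<^sup>2 + b\<^sup>2" for a b :: real
    using sum_squares_bound[of "\<bar>a\<bar>" "\<bar>b\<bar>"] mult_nonneg_nonneg[OF abs_ge_zero[of a] abs_ge_zero[of b]]
    unfolding abs_mult power2_abs by linarith
  then show "AE x in lebesgue. norm (f x * g x) \<le> norm ((f x)\<^sup>2 + (g x)\<^sup>2)" by simp
qed measurable

lemma Lp_space_2_add:
  assumes [measurable]: "f \<in> Lp_space 2" "g \<in> Lp_space 2"
  shows "(\<lambda>x. f x + g x) \<in> Lp_space 2"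
  using assms Lp_space_2_mult_integrable[OF assms] by (auto simp: Lp_space_2_iff power2_sum mult.assoc)

lemma Lp_space_2_scale: "f \<in> Lp_space 2 \<Longrightarrow> (\<lambda>x. r * f x) \<in> Lp_space 2"
  by (auto simp: Lp_space_2_iff power_mult_distrib)

lemma Lp_space_2_uminus: "f \<in> Lp_space 2 \<Longrightarrow> (\<lambda>x. - f x) \<in> Lp_space 2"
  using Lp_space_2_scale[of f "- 1"] by simp

lemma Lp_space_2_diff: "f \<in> Lp_space 2 \<Longrightarrow> g \<in> Lp_space 2 \<Longrightarrow> (\<lambda>x. f x - g x) \<in> Lp_space 2"
  using Lp_space_2_add[OF _ Lp_space_2_uminus] by fastforce

\<comment> \<open>The form theory lives on a type of class \<open>real_inner\<close> and
  \<open>banach\<close>, so square integrable functions have to become a type. The quotient is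
  partial: a function outside \<open>Lp_space 2\<close> is related to nothing.\<close>
quotient_type (overloaded) 'a L2 = "'a::euclidean_space \<Rightarrow> real" / partial:
  "\<lambda>f g. f \<in> Lp_space 2 \<and> g \<in> Lp_space 2 \<and> (AE x in lebesgue. f x = g x)"
proof (rule part_equivpI)
  show "\<exists>f::'a \<Rightarrow> real. f \<in> Lp_space 2 \<and> f \<in> Lp_space 2 \<and> (AE x in lebesgue. f x = f x)"
    by (rule exI[of _ "\<lambda>_. 0"]) (simp add: Lp_space_2_iff)
qed (auto intro!: sympI transpI elim: AE_mp)

lemma rep_L2_in [simp, measurable_dest]: "rep_L2 u \<in> Lp_space 2"
  using Quotient3_rep_reflp[OF Quotient3_L2, of u] by blast

lemma rep_L2_measurable [measurable]: "rep_L2 u \<in> borel_measurable lebesgue"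
  using rep_L2_in Lp_space_2_iff by blast

lemma abs_rep_L2 [simp]: "abs_L2 (rep_L2 u) = u"
  by (rule Quotient3_abs_rep[OF Quotient3_L2])

lemma rep_abs_L2: "f \<in> Lp_space 2 \<Longrightarrow> AE x in lebesgue. rep_L2 (abs_L2 f) x = f x"
  using rep_abs_rsp_left[OF Quotient3_L2, of f f] by auto

lemma abs_L2_eqI: "f \<in> Lp_space 2 \<Longrightarrow> g \<in> Lp_space 2 \<Longrightarrow> (AE x in lebesgue. f x = g x) \<Longrightarrow> abs_L2 f = abs_L2 g"
  using Quotient3_rel_abs[OF Quotient3_L2, of f g] by blast

instantiation L2 :: (euclidean_space) real_inner
begin

definition "0 = abs_L2 (\<lambda>_. 0)"
definition "u + v = abs_L2 (\<lambda>x. rep_L2 u x + rep_L2 v x)"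
definition "u - v = abs_L2 (\<lambda>x. rep_L2 u x - rep_L2 v x)"
definition "- u = abs_L2 (\<lambda>x. - rep_L2 u x)"
definition "r *\<^sub>R u = abs_L2 (\<lambda>x. r * rep_L2 u x)"
definition "u \<bullet> v = (\<integral>x. rep_L2 u x * rep_L2 v x \<partial>lebesgue)"
definition norm_L2 :: "'a L2 \<Rightarrow> real" where "norm_L2 u = sqrt (u \<bullet> u)"
definition sgn_L2 :: "'a L2 \<Rightarrow> 'a L2" where "sgn_L2 u = inverse (norm u) *\<^sub>R u"
definition dist_L2 :: "'a L2 \<Rightarrow> 'a L2 \<Rightarrow> real" where "dist_L2 u v = norm (u - v)"
definition uniformity_L2 :: "('a L2 \<times> 'a L2) filter" where
  "uniformity_L2 = (INF e\<in>{0<..}. principal {(x, y). dist x y < e})"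
definition open_L2 :: "'a L2 set \<Rightarrow> bool" where
  "open_L2 U \<longleftrightarrow> (\<forall>x\<in>U. eventually (\<lambda>(x', y). x' = x \<longrightarrow> y \<in> U) uniformity)"

text \<open>The operations go through arbitrarily chosen representatives, so these laws can hold
  only almost everywhere.\<close>

lemma rep_L2_simps:
  fixes u v :: "'a L2"
  shows rep_L2_0: "AE x in lebesgue. rep_L2 (0 :: 'a L2) x = 0"
    and rep_L2_add: "AE x in lebesgue. rep_L2 (u + v) x = rep_L2 u x + rep_L2 v x"
    and rep_L2_diff: "AE x in lebesgue. rep_L2 (u - v) x = rep_L2 u x - rep_L2 v x"
    and rep_L2_uminus: "AE x in lebesgue. rep_L2 (- u) x = - rep_L2 u x"
    and rep_L2_scale: "AE x in lebesgue. rep_L2 (r *\<^sub>R u) x = r * rep_L2 u x"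
  unfolding zero_L2_def plus_L2_def minus_L2_def uminus_L2_def scaleR_L2_def
  by (intro rep_abs_L2 Lp_space_2_add Lp_space_2_diff Lp_space_2_uminus Lp_space_2_scale rep_L2_in
    | simp add: Lp_space_2_iff)+

lemma L2_eqI: "(AE x in lebesgue. rep_L2 u x = rep_L2 v x) \<Longrightarrow> u = v"
  using abs_L2_eqI[of "rep_L2 u" "rep_L2 v"] by simp

instance
proof
  fix u v w :: "'a L2" and r s :: real
  show "u + v + w = u + (v + w)"
    by (rule L2_eqI) (use rep_L2_add[of u v] rep_L2_add[of "u + v" w] rep_L2_add[of v w] rep_L2_add[of u "v + w"] in eventually_elim, simp)
  show "u + v = v + u"
    by (rule L2_eqI) (use rep_L2_add[of u v] rep_L2_add[of v u] in eventually_elim, simp)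
  show "0 + u = u"
    by (rule L2_eqI) (use rep_L2_add[of 0 u] rep_L2_0 in eventually_elim, simp)
  show "- u + u = 0"
    by (rule L2_eqI) (use rep_L2_add[of "- u" u] rep_L2_uminus[of u] rep_L2_0 in eventually_elim, simp)
  show "u - v = u + - v"
    by (rule L2_eqI) (use rep_L2_add[of u "- v"] rep_L2_diff[of u v] rep_L2_uminus[of v] in eventually_elim, simp)
  show "r *\<^sub>R (u + v) = r *\<^sub>R u + r *\<^sub>R v"
    by (rule L2_eqI) (use rep_L2_add[of u v] rep_L2_scale[of r "u + v"] rep_L2_scale[of r u] rep_L2_scale[of r v]
      rep_L2_add[of "r *\<^sub>R u" "r *\<^sub>R v"] in eventually_elim, simp add: algebra_simps)
  show "(r + s) *\<^sub>R u = r *\<^sub>R u + s *\<^sub>R u"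
    by (rule L2_eqI) (use rep_L2_add[of "r *\<^sub>R u" "s *\<^sub>R u"] rep_L2_scale[of "r + s" u] rep_L2_scale[of r u] rep_L2_scale[of s u]
      in eventually_elim, simp add: algebra_simps)
  show "r *\<^sub>R s *\<^sub>R u = (r * s) *\<^sub>R u"
    by (rule L2_eqI) (use rep_L2_scale[of "r * s" u] rep_L2_scale[of r "s *\<^sub>R u"] rep_L2_scale[of s u]
      in eventually_elim, simp add: algebra_simps)
  show "1 *\<^sub>R u = u"
    by (rule L2_eqI) (use rep_L2_scale[of 1 u] in eventually_elim, simp)
  show "dist u v = norm (u - v)" by (rule dist_L2_def)
  show "sgn u = inverse (norm u) *\<^sub>R u" by (rule sgn_L2_def)
  show "uniformity = (INF e\<in>{0<..}. principal {(x :: 'a L2, y). dist x y < e})" by (rule uniformity_L2_def)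
  show "open U \<longleftrightarrow> (\<forall>x\<in>U. eventually (\<lambda>(x', y). x' = x \<longrightarrow> y \<in> U) uniformity)" for U :: "'a L2 set"
    by (rule open_L2_def)
  show "u \<bullet> v = v \<bullet> u" by (simp add: inner_L2_def mult.commute)
  show "(u + v) \<bullet> w = u \<bullet> w + v \<bullet> w"
  proof -
    have "(u + v) \<bullet> w = (\<integral>x. rep_L2 u x * rep_L2 w x + rep_L2 v x * rep_L2 w x \<partial>lebesgue)"
      unfolding inner_L2_def
      by (rule integral_cong_AE) (measurable, use rep_L2_add[of u v] in eventually_elim, simp add: algebra_simps)
    then show ?thesis
      by (simp add: inner_L2_def Lp_space_2_mult_integrable)
  qed
  show "(r *\<^sub>R u) \<bullet> v = r * (u \<bullet> v)"
  proof -
    have "(r *\<^sub>R u) \<bullet> v = (\<integral>x. r * (rep_L2 u x * rep_L2 v x) \<partial>lebesgue)"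
      unfolding inner_L2_def
      by (rule integral_cong_AE) (measurable, use rep_L2_scale[of r u] in eventually_elim, simp add: algebra_simps)
    then show ?thesis by (simp add: inner_L2_def)
  qed
  show "0 \<le> u \<bullet> u" by (simp add: inner_L2_def)
  show "u \<bullet> u = 0 \<longleftrightarrow> u = 0"
  proof
    assume "u \<bullet> u = 0"
    then have "AE x in lebesgue. rep_L2 u x * rep_L2 u x = 0"
      unfolding inner_L2_def
      by (subst (asm) integral_nonneg_eq_0_iff_AE) (auto intro: Lp_space_2_mult_integrable)
    with rep_L2_0 have "AE x in lebesgue. rep_L2 u x = rep_L2 0 x"
      by eventually_elim simp
    then show "u = 0" by (rule L2_eqI)
  next
    assume "u = 0"
    have "(\<integral>x. rep_L2 (0 :: 'a L2) x * rep_L2 (0 :: 'a L2) x \<partial>lebesgue) = (\<integral>x. 0 \<partial>(lebesgue :: 'a measure))"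
      by (rule integral_cong_AE) (measurable, use rep_L2_0 in eventually_elim, simp)
    then show "u \<bullet> u = 0" by (simp add: inner_L2_def \<open>u = 0\<close>)
  qed
  show "norm u = sqrt (u \<bullet> u)" by (rule norm_L2_def)
qed

end

section \<open>Passage between functions and classes, and completeness\<close>

lemma inner_L2_abs:
  assumes [measurable]: "f \<in> Lp_space 2" "g \<in> Lp_space 2"
  shows "abs_L2 f \<bullet> abs_L2 g = (\<integral>x. f x * g x \<partial>lebesgue)"
  unfolding inner_L2_def
  by (rule integral_cong_AE) (measurable, use rep_abs_L2[OF assms(1)] rep_abs_L2[OF assms(2)] in eventually_elim, simp)

lemma norm_L2_abs: "f \<in> Lp_space 2 \<Longrightarrow> norm (abs_L2 f) = Lp_norm 2 f"
  by (simp add: norm_eq_sqrt_inner inner_L2_abs Lp_norm_2_eq power2_eq_square)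

lemma Lp_norm_2_cong_AE:
  assumes [measurable]: "f \<in> borel_measurable lebesgue" "g \<in> borel_measurable lebesgue"
    and ae: "AE x in lebesgue. f x = g x"
  shows "Lp_norm 2 f = Lp_norm 2 g"
proof -
  have "(\<integral>x. (f x)\<^sup>2 \<partial>lebesgue) = (\<integral>x. (g x)\<^sup>2 \<partial>lebesgue)"
    by (rule integral_cong_AE) (measurable, use ae in eventually_elim, simp)
  then show ?thesis by (simp add: Lp_norm_2_eq)
qed

lemma Lp_norm_2_rep: "Lp_norm 2 (rep_L2 u) = norm u"
  using norm_L2_abs[OF rep_L2_in, of u] by simp

lemma nn_integral_square_L2:
  assumes "f \<in> Lp_space 2"
  shows "(\<integral>\<^sup>+x. ennreal ((f x)\<^sup>2) \<partial>lebesgue) = ennreal ((norm (abs_L2 f))\<^sup>2)"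
  using assms
  by (subst nn_integral_eq_integral) (auto simp: norm_L2_abs Lp_space_2_iff Lp_norm_2_eq)

lemma abs_L2_diff:
  assumes "f \<in> Lp_space 2" "g \<in> Lp_space 2"
  shows "abs_L2 (\<lambda>x. f x - g x) = abs_L2 f - abs_L2 g"
  unfolding minus_L2_def
proof (rule abs_L2_eqI)
  show "AE x in lebesgue. f x - g x = rep_L2 (abs_L2 f) x - rep_L2 (abs_L2 g) x"
    using rep_abs_L2[OF assms(1)] rep_abs_L2[OF assms(2)] by eventually_elim simp
qed (simp_all add: Lp_space_2_diff assms)

lemma abs_L2_diff_rep: "abs_L2 (\<lambda>x. rep_L2 u x - rep_L2 v x) = u - v"
  by (simp add: minus_L2_def)

text \<open>Fatou's lemma in the form shared by the completeness of \<open>L2\<close> and the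
  closedness of the energy.\<close>

lemma nn_integral_le_limit:
  assumes [measurable]: "\<And>k. h k \<in> borel_measurable M"
    and lim: "AE x in M. (\<lambda>k. h k x) \<longlonglongrightarrow> H x"
    and le: "\<And>k. (\<integral>\<^sup>+x. h k x \<partial>M) \<le> c k" and c: "c \<longlonglongrightarrow> (C :: ennreal)"
  shows "(\<integral>\<^sup>+x. H x \<partial>M) \<le> C"
proof -
  have "(\<integral>\<^sup>+x. H x \<partial>M) = (\<integral>\<^sup>+x. liminf (\<lambda>k. h k x) \<partial>M)"
    by (rule nn_integral_cong_AE) (use lim in eventually_elim, simp add: lim_imp_Liminf)
  also have "\<dots> \<le> liminf (\<lambda>k. \<integral>\<^sup>+x. h k x \<partial>M)"
    by (rule nn_integral_liminf) simp
  also have "\<dots> \<le> liminf c"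
    by (rule Liminf_mono) (simp add: le)
  also have "\<dots> = C" using c by (simp add: lim_imp_Liminf)
  finally show ?thesis .
qed

text \<open>The increments \<open>d k\<close> of a fast subsequence have squared norm at most
  \<open>(1/4) ^ k\<close>. Weighted by \<open>2 ^ k\<close> their squares still have a finite total
  integral, so almost everywhere \<open>d k x\<close> is bounded by a multiple of
  \<open>sqrt (1/2) ^ k\<close> and the telescoping series converges.\<close>

lemma L2_AE_convergent_subseq:
  fixes X :: "nat \<Rightarrow> 'a::euclidean_space L2"
  assumes "Cauchy X"
  obtains r where "strict_mono r" "AE x in lebesgue. convergent (\<lambda>k. rep_L2 (X (r k)) x)"
proof -
  have "\<forall>k. \<exists>N. \<forall>m\<ge>N. \<forall>n\<ge>N. dist (X m) (X n) < (1/2) ^ k"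
    using assms unfolding Cauchy_def by simp
  then obtain N where N: "\<And>k m n. m \<ge> N k \<Longrightarrow> n \<ge> N k \<Longrightarrow> dist (X m) (X n) < (1/2) ^ k" by metis
  \<comment> \<open>Partial sums make the indices strictly increasing and at least
    \<open>N k\<close> at the same time.\<close>
  define r where "r k = (\<Sum>j\<le>k. Suc (N j))" for k
  have r: "strict_mono r" by (rule strict_monoI_Suc) (simp add: r_def)
  have rN: "N k \<le> r k" for k by (cases k) (auto simp: r_def)
  define d where "d k x = rep_L2 (X (r (Suc k))) x - rep_L2 (X (r k)) x" for k x
  have dL: "d k \<in> Lp_space 2" for k unfolding d_def[abs_def] by (intro Lp_space_2_diff rep_L2_in)
  have [measurable]: "d k \<in> borel_measurable lebesgue" for k using dL by (rule Lp_space_2_measurable)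
  have d: "(\<integral>\<^sup>+x. ennreal ((d k x)\<^sup>2) \<partial>lebesgue) \<le> ennreal ((1/4) ^ k)" for k
  proof -
    have "norm (X (r (Suc k)) - X (r k)) < (1/2) ^ k"
      using N[of k "r (Suc k)" "r k"] rN[of k] strict_mono_less_eq[OF r, of k "Suc k"] by (simp add: dist_norm)
    then have "(norm (X (r (Suc k)) - X (r k)))\<^sup>2 \<le> ((1/2) ^ k)\<^sup>2"
      by (intro power_mono) auto
    also have "\<dots> = (1/4 :: real) ^ k"
      by (simp add: power2_eq_square power_mult_distrib[symmetric])
    finally have "(norm (X (r (Suc k)) - X (r k)))\<^sup>2 \<le> (1/4) ^ k" .
    moreover have "abs_L2 (d k) = X (r (Suc k)) - X (r k)"
      unfolding d_def[abs_def] by (rule abs_L2_diff_rep)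
    ultimately show ?thesis
      by (subst nn_integral_square_L2[OF dL]) (simp add: ennreal_leI)
  qed
  have "(\<integral>\<^sup>+x. (\<Sum>k. ennreal (2 ^ k * (d k x)\<^sup>2)) \<partial>lebesgue) = (\<Sum>k. \<integral>\<^sup>+x. ennreal (2 ^ k * (d k x)\<^sup>2) \<partial>lebesgue)"
    by (rule nn_integral_suminf) measurable
  also have "\<dots> = (\<Sum>k. ennreal (2 ^ k) * (\<integral>\<^sup>+x. ennreal ((d k x)\<^sup>2) \<partial>lebesgue))"
    by (subst nn_integral_cmult[symmetric]) (auto simp: ennreal_mult)
  also have "\<dots> \<le> (\<Sum>k. ennreal ((1/2) ^ k))"
  proof (rule suminf_le)
    fix k
    have "ennreal (2 ^ k) * (\<integral>\<^sup>+x. ennreal ((d k x)\<^sup>2) \<partial>lebesgue) \<le> ennreal (2 ^ k) * ennreal ((1/4) ^ k)"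
      by (intro mult_left_mono d) simp
    also have "\<dots> = ennreal ((1/2) ^ k)"
      by (simp add: ennreal_mult[symmetric] power_mult_distrib[symmetric])
    finally show "ennreal (2 ^ k) * (\<integral>\<^sup>+x. ennreal ((d k x)\<^sup>2) \<partial>lebesgue) \<le> ennreal ((1/2) ^ k)" .
  qed auto
  also have "\<dots> = ennreal (\<Sum>k. (1/2) ^ k)"
    by (rule suminf_ennreal_eq) (auto intro!: summable_sums summable_geometric)
  finally have "(\<integral>\<^sup>+x. (\<Sum>k. ennreal (2 ^ k * (d k x)\<^sup>2)) \<partial>lebesgue) \<noteq> \<infinity>"
    by (auto simp: top_unique)
  then have "AE x in lebesgue. (\<Sum>k. ennreal (2 ^ k * (d k x)\<^sup>2)) \<noteq> \<infinity>"
    by (intro nn_integral_PInf_AE) measurable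
  then have "AE x in lebesgue. convergent (\<lambda>k. rep_L2 (X (r k)) x)"
  proof eventually_elim
    case (elim x)
    have s: "summable (\<lambda>k. 2 ^ k * (d k x)\<^sup>2)"
      using elim by (intro summable_suminf_not_top) auto
    have "Bseq (\<lambda>k. 2 ^ k * (d k x)\<^sup>2)"
      by (intro convergent_imp_Bseq convergentI[OF summable_LIMSEQ_zero[OF s]])
    then obtain K where K: "\<And>k. 2 ^ k * (d k x)\<^sup>2 \<le> K"
      by (elim BseqE) auto
    have "\<bar>d k x\<bar> \<le> sqrt K * (sqrt (1/2)) ^ k" for k
    proof -
      have "(d k x)\<^sup>2 \<le> K * (1/2) ^ k"
        using K[of k] by (simp add: field_simps power_one_over)
      then have "sqrt ((d k x)\<^sup>2) \<le> sqrt (K * (1/2) ^ k)" by (rule real_sqrt_le_mono)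
      then show ?thesis unfolding real_sqrt_abs unfolding real_sqrt_mult real_sqrt_power .
    qed
    then have le: "norm (d k x) \<le> sqrt K * (sqrt (1/2)) ^ k" for k by (simp only: real_norm_def)
    have "summable (\<lambda>k. sqrt K * (sqrt (1/2)) ^ k)"
      by (intro summable_mult summable_geometric) (simp add: real_sqrt_divide)
    then have "summable (\<lambda>k. d k x)"
      by (rule summable_comparison_test') (rule le)
    then have "(\<lambda>n. \<Sum>k<n. d k x) \<longlonglongrightarrow> (\<Sum>k. d k x)" by (rule summable_LIMSEQ)
    moreover have "(\<Sum>k<n. d k x) = rep_L2 (X (r n)) x - rep_L2 (X (r 0)) x" for n
      unfolding d_def by (rule sum_lessThan_telescope)
    ultimately have "(\<lambda>n. rep_L2 (X (r n)) x - rep_L2 (X (r 0)) x) \<longlonglongrightarrow> (\<Sum>k. d k x)" by simp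
    from tendsto_add[OF this tendsto_const[of "rep_L2 (X (r 0)) x"]]
    have "(\<lambda>n. rep_L2 (X (r n)) x) \<longlonglongrightarrow> (\<Sum>k. d k x) + rep_L2 (X (r 0)) x"
      by simp
    then show ?case by (auto simp: convergent_def)
  qed
  with r show ?thesis by (rule that)
qed

instance L2 :: (euclidean_space) banach
proof
  fix X :: "nat \<Rightarrow> 'a L2" assume X: "Cauchy X"
  obtain r where r: "strict_mono r" "AE x in lebesgue. convergent (\<lambda>k. rep_L2 (X (r k)) x)"
    using L2_AE_convergent_subseq[OF X] .
  define G where "G x = lim (\<lambda>k. rep_L2 (X (r k)) x)" for x
  have [measurable]: "G \<in> borel_measurable lebesgue" unfolding G_def[abs_def] by measurable
  have lim: "AE x in lebesgue. (\<lambda>k. rep_L2 (X (r k)) x) \<longlonglongrightarrow> G x"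
    using r(2) by eventually_elim (simp add: G_def convergent_LIMSEQ_iff)
  \<comment> \<open>As a nonnegative integral this makes sense before \<open>G\<close> is known to
    be square integrable; that property is deduced from it.\<close>
  have bound: "(\<integral>\<^sup>+x. ennreal ((G x - rep_L2 (X n) x)\<^sup>2) \<partial>lebesgue) \<le> ennreal (e\<^sup>2)"
    if e: "\<And>k. norm (X (r (k + j)) - X n) \<le> e" for n j e
  proof (rule nn_integral_le_limit)
    show "(\<lambda>x. ennreal ((rep_L2 (X (r (k + j))) x - rep_L2 (X n) x)\<^sup>2)) \<in> borel_measurable lebesgue" for k
      by measurable
    show "AE x in lebesgue. (\<lambda>k. ennreal ((rep_L2 (X (r (k + j))) x - rep_L2 (X n) x)\<^sup>2)) \<longlonglongrightarrow> ennreal ((G x - rep_L2 (X n) x)\<^sup>2)"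
      using lim
    proof eventually_elim
      case (elim x)
      then have "(\<lambda>k. rep_L2 (X (r (k + j))) x) \<longlonglongrightarrow> G x" by (rule LIMSEQ_ignore_initial_segment)
      then show ?case by (intro tendsto_intros)
    qed
    show "(\<integral>\<^sup>+x. ennreal ((rep_L2 (X (r (k + j))) x - rep_L2 (X n) x)\<^sup>2) \<partial>lebesgue) \<le> ennreal (e\<^sup>2)" for k
      using e[of k]
      by (subst nn_integral_square_L2) (auto intro!: Lp_space_2_diff ennreal_leI power_mono simp: abs_L2_diff_rep)
    show "(\<lambda>_. ennreal (e\<^sup>2)) \<longlonglongrightarrow> ennreal (e\<^sup>2)" by simp
  qed
  have diff: "(\<lambda>x. G x - rep_L2 (X n) x) \<in> Lp_space 2 \<and> norm (abs_L2 (\<lambda>x. G x - rep_L2 (X n) x)) \<le> e"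
    if e: "\<And>k. norm (X (r (k + j)) - X n) \<le> e" for n j e
  proof
    have e0: "0 \<le> e" using e[of 0] norm_ge_zero order_trans by blast
    show *: "(\<lambda>x. G x - rep_L2 (X n) x) \<in> Lp_space 2"
      unfolding Lp_space_2_iff
    proof
      show "integrable lebesgue (\<lambda>x. (G x - rep_L2 (X n) x)\<^sup>2)"
        by (rule integrableI_nonneg) (use bound[OF e] in \<open>auto simp: less_top[symmetric] top_unique\<close>)
    qed measurable
    have "ennreal ((norm (abs_L2 (\<lambda>x. G x - rep_L2 (X n) x)))\<^sup>2) \<le> ennreal (e\<^sup>2)"
      using bound[OF e] by (simp only: nn_integral_square_L2[OF *])
    then have "(norm (abs_L2 (\<lambda>x. G x - rep_L2 (X n) x)))\<^sup>2 \<le> e\<^sup>2" by simp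
    then show "norm (abs_L2 (\<lambda>x. G x - rep_L2 (X n) x)) \<le> e"
      by (rule power2_le_imp_le) (rule e0)
  qed
  have cauchy: "\<exists>N. \<forall>n\<ge>N. \<forall>k. norm (X (r (k + N)) - X n) \<le> e" if e: "0 < e" for e
  proof -
    obtain N where N: "\<And>m n. m \<ge> N \<Longrightarrow> n \<ge> N \<Longrightarrow> dist (X m) (X n) < e"
      using metric_CauchyD[OF X e] by auto
    have "r (k + N) \<ge> N" for k
      using seq_suble[OF r(1), of "k + N"] by linarith
    then show ?thesis using N unfolding dist_norm by (meson less_imp_le)
  qed
  obtain N where "\<And>k. norm (X (r (k + N)) - X N) \<le> 1" using cauchy[of 1] by auto
  from diff[OF this] have "(\<lambda>x. G x - rep_L2 (X N) x) \<in> Lp_space 2" by blast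
  then have "(\<lambda>x. (G x - rep_L2 (X N) x) + rep_L2 (X N) x) \<in> Lp_space 2"
    by (rule Lp_space_2_add) simp
  then have G: "G \<in> Lp_space 2" by simp
  have "X \<longlonglongrightarrow> abs_L2 G"
  proof (rule metric_LIMSEQ_I)
    fix e :: real assume "0 < e"
    then obtain N where N: "\<And>n k. n \<ge> N \<Longrightarrow> norm (X (r (k + N)) - X n) \<le> e / 2"
      using cauchy[of "e / 2"] by auto
    have "dist (X n) (abs_L2 G) < e" if "n \<ge> N" for n
    proof -
      have "abs_L2 (\<lambda>x. G x - rep_L2 (X n) x) = abs_L2 G - X n"
        using abs_L2_diff[OF G rep_L2_in] by simp
      then have "norm (abs_L2 G - X n) \<le> e / 2" using diff[OF N[OF that]] by simp
      then show ?thesis using \<open>0 < e\<close> by (simp add: dist_norm norm_minus_commute)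
    qed
    then show "\<exists>N. \<forall>n\<ge>N. dist (X n) (abs_L2 G) < e" by blast
  qed
  then show "convergent X" by (rule convergentI)
qed

lemma L2_AE_limit_subseq:
  fixes X :: "nat \<Rightarrow> 'a::euclidean_space L2"
  assumes X: "X \<longlonglongrightarrow> u"
  obtains r where "strict_mono r" "AE x in lebesgue. (\<lambda>k. rep_L2 (X (r k)) x) \<longlonglongrightarrow> rep_L2 u x"
proof -
  have "(\<lambda>n. (norm (X n - u))\<^sup>2) \<longlonglongrightarrow> 0"
    using tendsto_power[OF tendsto_norm_zero[OF LIM_zero[OF X]], of 2] by simp
  then have lim: "(\<lambda>n. \<integral>x. norm ((rep_L2 (X n) x - rep_L2 u x)\<^sup>2) \<partial>lebesgue) \<longlonglongrightarrow> 0"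
    by (simp add: norm_L2_abs Lp_space_2_diff Lp_norm_2_eq flip: abs_L2_diff_rep)
  obtain r where r: "strict_mono r" "AE x in lebesgue. (\<lambda>k. (rep_L2 (X (r k)) x - rep_L2 u x)\<^sup>2) \<longlonglongrightarrow> 0"
    using tendsto_L1_AE_subseq[OF _ lim] Lp_space_2_diff[OF rep_L2_in rep_L2_in] by (auto simp: Lp_space_2_iff)
  from r(2) have "AE x in lebesgue. (\<lambda>k. rep_L2 (X (r k)) x) \<longlonglongrightarrow> rep_L2 u x"
  proof eventually_elim
    case (elim x)
    from tendsto_real_sqrt[OF elim] show ?case
      by (simp add: tendsto_rabs_zero_iff LIM_zero_iff)
  qed
  with r(1) show ?thesis by (rule that)
qed

section \<open>The energy form of a Levy kernel\<close>

lemma null_sets_Times_UNIV: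
  fixes N :: "'a::euclidean_space set"
  assumes "N \<in> null_sets lborel"
  shows "N \<times> (UNIV :: 'b::euclidean_space set) \<in> null_sets lborel"
    and "(UNIV :: 'b set) \<times> N \<in> null_sets lborel"
proof -
  have "N \<times> (UNIV :: 'b set) \<in> sets (lborel \<Otimes>\<^sub>M lborel)" "(UNIV :: 'b set) \<times> N \<in> sets (lborel \<Otimes>\<^sub>M lborel)"
    using assms by (auto intro!: pair_measureI)
  moreover have "emeasure (lborel \<Otimes>\<^sub>M lborel) (N \<times> (UNIV :: 'b set)) = 0"
    "emeasure (lborel \<Otimes>\<^sub>M lborel) ((UNIV :: 'b set) \<times> N) = 0"
    using assms by (subst lborel.emeasure_pair_measure_Times; auto)+
  ultimately show "N \<times> (UNIV :: 'b set) \<in> null_sets lborel" "(UNIV :: 'b set) \<times> N \<in> null_sets lborel"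
    unfolding lborel_prod by (auto intro: null_setsI)
qed

text \<open>Between completed measures Borel measurability is not enough: preimages of null sets
  must be null as well. Here they are strips over null sets. This makes \<open>f (fst p)\<close>
  measurable for a merely Lebesgue measurable \<open>f\<close>.\<close>

lemma measurable_fst_lebesgue [measurable]:
  "fst \<in> (lebesgue :: ('a::euclidean_space \<times> 'b::euclidean_space) measure) \<rightarrow>\<^sub>M lebesgue"
proof (rule completion.measurable_completion2)
  show *: "fst \<in> (lebesgue :: ('a \<times> 'b) measure) \<rightarrow>\<^sub>M lborel"
    by (rule measurable_completion) (simp add: borel_measurable_continuous_onI continuous_on_fst)
  show "null_sets lborel \<subseteq> null_sets (distr (lebesgue :: ('a \<times> 'b) measure) lborel fst)"
  proof
    fix N :: "'a set" assume N: "N \<in> null_sets lborel"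
    have "emeasure (distr (lebesgue :: ('a \<times> 'b) measure) lborel fst) N = emeasure lebesgue (fst -` N \<inter> space (lebesgue :: ('a \<times> 'b) measure))"
      by (rule emeasure_distr[OF *]) (use N in auto)
    also have "fst -` N \<inter> space (lebesgue :: ('a \<times> 'b) measure) = N \<times> (UNIV :: 'b set)" by auto
    also have "emeasure lebesgue \<dots> = 0"
      by (intro null_setsD1 null_sets_completionI null_sets_Times_UNIV N)
    finally show "N \<in> null_sets (distr (lebesgue :: ('a \<times> 'b) measure) lborel fst)"
      using N by (intro null_setsI) auto
  qed
qed

lemma measurable_snd_lebesgue [measurable]:
  "snd \<in> (lebesgue :: ('b::euclidean_space \<times> 'a::euclidean_space) measure) \<rightarrow>\<^sub>M lebesgue"
proof (rule completion.measurable_completion2)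
  show *: "snd \<in> (lebesgue :: ('b \<times> 'a) measure) \<rightarrow>\<^sub>M lborel"
    by (rule measurable_completion) (simp add: borel_measurable_continuous_onI continuous_on_snd)
  show "null_sets lborel \<subseteq> null_sets (distr (lebesgue :: ('b \<times> 'a) measure) lborel snd)"
  proof
    fix N :: "'a set" assume N: "N \<in> null_sets lborel"
    have "emeasure (distr (lebesgue :: ('b \<times> 'a) measure) lborel snd) N = emeasure lebesgue (snd -` N \<inter> space (lebesgue :: ('b \<times> 'a) measure))"
      by (rule emeasure_distr[OF *]) (use N in auto)
    also have "snd -` N \<inter> space (lebesgue :: ('b \<times> 'a) measure) = (UNIV :: 'b set) \<times> N" by auto
    also have "emeasure lebesgue \<dots> = 0"
      by (intro null_setsD1 null_sets_completionI null_sets_Times_UNIV N)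
    finally show "N \<in> null_sets (distr (lebesgue :: ('b \<times> 'a) measure) lborel snd)"
      using N by (intro null_setsI) auto
  qed
qed

lemma AE_lebesgue_fst_snd:
  fixes P :: "'a::euclidean_space \<Rightarrow> bool"
  assumes "AE x in lebesgue. P x"
  shows "AE p in (lebesgue :: ('a \<times> 'b::euclidean_space) measure). P (fst p)"
    and "AE p in (lebesgue :: ('b \<times> 'a) measure). P (snd p)"
proof -
  obtain N where N: "N \<in> null_sets lborel" "{x. \<not> P x} \<subseteq> N"
    using assms unfolding AE_completion_iff by (auto elim!: AE_E simp: null_sets_def)
  show "AE p in (lebesgue :: ('a \<times> 'b) measure). P (fst p)"
    unfolding AE_completion_iff
    by (rule AE_I'[OF null_sets_Times_UNIV(1)[OF N(1)]]) (use N in auto)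
  show "AE p in (lebesgue :: ('b \<times> 'a) measure). P (snd p)"
    unfolding AE_completion_iff
    by (rule AE_I'[OF null_sets_Times_UNIV(2)[OF N(1)]]) (use N in auto)
qed

section \<open>Invariance under null sets and bilinearity of the energy\<close>

lemma levy_kernel_measurable [measurable_dest]:
  "levy_kernel J \<Longrightarrow> (\<lambda>p. J (fst p) (snd p)) \<in> borel_measurable lebesgue"
  by (simp add: levy_kernel_def case_prod_beta')

lemma levy_kernel_nonneg: "levy_kernel J \<Longrightarrow> 0 \<le> J x y"
  by (simp add: levy_kernel_def)

definition energy_density :: "('a \<Rightarrow> 'a \<Rightarrow> real) \<Rightarrow> ('a \<Rightarrow> real) \<Rightarrow> ('a \<Rightarrow> real) \<Rightarrow> 'a \<times> 'a \<Rightarrow> real" where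
  "energy_density J f g p = (f (fst p) - f (snd p)) * (g (fst p) - g (snd p)) * J (fst p) (snd p)"

lemma energy_eq: "energy J f g = (\<integral>p. energy_density J f g p \<partial>lebesgue) / 2"
  by (simp add: energy_def energy_density_def case_prod_beta')

lemma H_space_iff: "f \<in> H_space J \<longleftrightarrow> f \<in> Lp_space 2 \<and> integrable lebesgue (energy_density J f f)"
  by (simp add: H_space_def energy_density_def[abs_def] case_prod_beta')

lemma energy_density_nonneg: "levy_kernel J \<Longrightarrow> 0 \<le> energy_density J f f p"
  by (simp add: energy_density_def levy_kernel_nonneg)

lemma energy_density_measurable [measurable]:
  assumes [measurable]: "levy_kernel J" "f \<in> borel_measurable lebesgue" "g \<in> borel_measurable lebesgue"
  shows "energy_density J f g \<in> borel_measurable lebesgue"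
  unfolding energy_density_def[abs_def] by measurable

lemma energy_density_cong_AE:
  assumes f: "AE x in lebesgue. f x = f' x" and g: "AE x in lebesgue. g x = g' x"
  shows "AE p in lebesgue. energy_density J f g p = energy_density J f' g' p"
  using AE_lebesgue_fst_snd(1)[OF f] AE_lebesgue_fst_snd(2)[OF f]
    AE_lebesgue_fst_snd(1)[OF g] AE_lebesgue_fst_snd(2)[OF g]
  by eventually_elim (simp add: energy_density_def)

lemma energy_cong_AE:
  assumes [measurable]: "levy_kernel J" "f \<in> borel_measurable lebesgue" "g \<in> borel_measurable lebesgue"
    "f' \<in> borel_measurable lebesgue" "g' \<in> borel_measurable lebesgue"
    and f: "AE x in lebesgue. f x = f' x" and g: "AE x in lebesgue. g x = g' x"
  shows "energy J f g = energy J f' g'"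
  unfolding energy_eq
  by (intro arg_cong[where f="\<lambda>x. x / 2"] integral_cong_AE energy_density_cong_AE f g) measurable

lemma H_space_cong_AE:
  assumes [measurable]: "levy_kernel J" "f' \<in> Lp_space 2"
    and f: "AE x in lebesgue. f x = f' x" and H: "f \<in> H_space J"
  shows "f' \<in> H_space J"
proof -
  have [measurable]: "f \<in> Lp_space 2" using H by (simp add: H_space_iff)
  have "integrable lebesgue (energy_density J f f)" using H by (simp add: H_space_iff)
  then have "integrable lebesgue (energy_density J f' f')"
    by (rule integrable_cong_AE_imp) (measurable, rule energy_density_cong_AE[OF f f])
  then show ?thesis using assms by (simp add: H_space_iff)
qed

lemma energy_density_integrable:
  assumes J [measurable]: "levy_kernel J" and f: "f \<in> H_space J" and g: "g \<in> H_space J"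
  shows "integrable lebesgue (energy_density J f g)"
proof (rule Bochner_Integration.integrable_bound)
  have [measurable]: "f \<in> Lp_space 2" "g \<in> Lp_space 2" using f g by (auto simp: H_space_iff)
  show "integrable lebesgue (\<lambda>p. energy_density J f f p + energy_density J g g p)"
    using f g by (intro Bochner_Integration.integrable_add) (auto simp: H_space_iff)
  show "energy_density J f g \<in> borel_measurable lebesgue" by measurable
  have "\<bar>a * b\<bar> \<le> a * a + b * b" for a b :: real
    using sum_squares_bound[of "\<bar>a\<bar>" "\<bar>b\<bar>"] mult_nonneg_nonneg[OF abs_ge_zero[of a] abs_ge_zero[of b]]
    unfolding abs_mult power2_abs power2_eq_square by linarith
  then have "\<bar>a * b\<bar> * j \<le> \<bar>a * a * j + b * b * j\<bar>" if "0 \<le> j" for a b j :: real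
    using that mult_right_mono[of "\<bar>a * b\<bar>" "a * a + b * b" j] by (simp add: algebra_simps)
  from this[OF levy_kernel_nonneg[OF J]] levy_kernel_nonneg[OF J]
  show "AE p in lebesgue. norm (energy_density J f g p) \<le> norm (energy_density J f f p + energy_density J g g p)"
    by (simp add: energy_density_def abs_mult)
qed

lemma H_space_add_energy:
  assumes J [measurable]: "levy_kernel J" and f: "f \<in> H_space J" and g: "g \<in> H_space J" and h: "h \<in> H_space J"
  shows H_space_add: "(\<lambda>x. f x + g x) \<in> H_space J"
    and energy_add: "energy J (\<lambda>x. f x + g x) h = energy J f h + energy J g h"
proof -
  have [measurable]: "f \<in> Lp_space 2" "g \<in> Lp_space 2" using f g by (auto simp: H_space_iff)
  have "energy_density J (\<lambda>x. f x + g x) (\<lambda>x. f x + g x) =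
    (\<lambda>p. energy_density J f f p + 2 * energy_density J f g p + energy_density J g g p)"
    by (simp add: energy_density_def fun_eq_iff algebra_simps)
  then show "(\<lambda>x. f x + g x) \<in> H_space J"
    using energy_density_integrable[OF J] f g by (simp add: H_space_iff Lp_space_2_add)
  have "energy_density J (\<lambda>x. f x + g x) h = (\<lambda>p. energy_density J f h p + energy_density J g h p)"
    by (simp add: energy_density_def fun_eq_iff algebra_simps)
  then show "energy J (\<lambda>x. f x + g x) h = energy J f h + energy J g h"
    using energy_density_integrable[OF J] f g h by (simp add: energy_eq add_divide_distrib)
qed

lemma H_space_scale_energy:
  assumes J [measurable]: "levy_kernel J" and f: "f \<in> H_space J"
  shows H_space_scale: "(\<lambda>x. r * f x) \<in> H_space J"
    and energy_scale: "energy J (\<lambda>x. r * f x) h = r * energy J f h"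
proof -
  have *: "energy_density J (\<lambda>x. r * f x) h = (\<lambda>p. r * energy_density J f h p)" for h
    by (simp add: energy_density_def fun_eq_iff algebra_simps)
  have "energy_density J (\<lambda>x. r * f x) (\<lambda>x. r * f x) = (\<lambda>p. (r * r) * energy_density J f f p)"
    by (simp add: energy_density_def fun_eq_iff algebra_simps)
  then show "(\<lambda>x. r * f x) \<in> H_space J"
    using f by (simp add: H_space_iff Lp_space_2_scale)
  show "energy J (\<lambda>x. r * f x) h = r * energy J f h"
    by (simp add: energy_eq *)
qed

lemma energy_commute: "energy J f g = energy J g f"
  by (simp add: energy_eq energy_density_def mult.commute[of "f _ - f _"])

lemma nn_integral_energy_density:
  assumes J: "levy_kernel J" and f: "f \<in> H_space J"
  shows "(\<integral>\<^sup>+p. ennreal (energy_density J f f p) \<partial>lebesgue) = ennreal (2 * energy J f f)"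
  using energy_density_integrable[OF J f f] energy_density_nonneg[OF J]
  by (subst nn_integral_eq_integral) (auto simp: energy_eq)

text \<open>Membership is tested on the chosen representative; by \<open>H_space_cong_AE\<close> the
  choice is immaterial.\<close>

definition form_domain :: "('a \<Rightarrow> 'a \<Rightarrow> real) \<Rightarrow> 'a::euclidean_space L2 set" where
  "form_domain J = {u. rep_L2 u \<in> H_space J}"

definition form_energy :: "('a \<Rightarrow> 'a \<Rightarrow> real) \<Rightarrow> 'a::euclidean_space L2 \<Rightarrow> 'a L2 \<Rightarrow> real" where
  "form_energy J u v = energy J (rep_L2 u) (rep_L2 v)"

text \<open>The analytic content is closedness: along a subsequence the functions converge almost
  everywhere, hence so do the energy densities on the product, and Fatou's lemma applies to
  them.\<close>

lemma closed_form_levy: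
  fixes J :: "'a::euclidean_space \<Rightarrow> 'a \<Rightarrow> real"
  assumes J: "levy_kernel J"
  shows "closed_form (form_domain J) (form_energy J)"
proof
  have add: "(\<lambda>x. rep_L2 u x + rep_L2 v x) \<in> H_space J" if "u \<in> form_domain J" "v \<in> form_domain J" for u v :: "'a L2"
    using that H_space_add[OF J, of _ _ "rep_L2 u"] by (simp add: form_domain_def)
  have scale: "(\<lambda>x. r * rep_L2 u x) \<in> H_space J" if "u \<in> form_domain J" for u :: "'a L2" and r
    using that H_space_scale[OF J] by (simp add: form_domain_def)
  show "subspace (form_domain J)"
  proof (rule subspaceI)
    have "(\<lambda>_. 0 :: real) \<in> H_space J"
      by (simp add: H_space_iff Lp_space_2_iff energy_density_def[abs_def])
    then show "0 \<in> form_domain J"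
      unfolding form_domain_def mem_Collect_eq
      by (rule H_space_cong_AE[OF J rep_L2_in, rotated]) (use rep_L2_0 in eventually_elim, simp)
    fix u v :: "'a L2" and r :: real assume u: "u \<in> form_domain J"
    show "r *\<^sub>R u \<in> form_domain J"
      unfolding form_domain_def mem_Collect_eq
      by (rule H_space_cong_AE[OF J rep_L2_in _ scale[OF u, where r=r]]) (use rep_L2_scale[of r u] in eventually_elim, simp)
    assume v: "v \<in> form_domain J"
    show "u + v \<in> form_domain J"
      unfolding form_domain_def mem_Collect_eq
      by (rule H_space_cong_AE[OF J rep_L2_in _ add[OF u v]]) (use rep_L2_add[of u v] in eventually_elim, simp)
  qed
  fix u v w :: "'a L2" and r :: real
  show "form_energy J u v = form_energy J v u" by (simp add: form_energy_def energy_commute)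
  show "0 \<le> form_energy J u u"
    unfolding form_energy_def energy_eq
    by (intro divide_nonneg_nonneg integral_nonneg_AE) (simp_all add: energy_density_nonneg[OF J])
  assume u: "u \<in> form_domain J" and w: "w \<in> form_domain J"
  show "form_energy J (r *\<^sub>R u) w = r * form_energy J u w"
  proof -
    have "form_energy J (r *\<^sub>R u) w = energy J (\<lambda>x. r * rep_L2 u x) (rep_L2 w)"
      unfolding form_energy_def
      by (rule energy_cong_AE[OF J]) (auto intro: rep_L2_scale Lp_space_2_measurable)
    then show ?thesis
      using u by (simp add: energy_scale[OF J] form_energy_def form_domain_def)
  qed
  assume v: "v \<in> form_domain J"
  show "form_energy J (u + v) w = form_energy J u w + form_energy J v w"
  proof -
    have "form_energy J (u + v) w = energy J (\<lambda>x. rep_L2 u x + rep_L2 v x) (rep_L2 w)"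
      unfolding form_energy_def
      by (rule energy_cong_AE[OF J]) (auto intro: rep_L2_add Lp_space_2_measurable)
    then show ?thesis
      using u v w by (simp add: energy_add[OF J] form_energy_def form_domain_def)
  qed
next
  fix X and u :: "'a L2" and e
  assume X: "\<And>n. X n \<in> form_domain J" "X \<longlonglongrightarrow> u" and e: "(\<lambda>n. form_energy J (X n) (X n)) \<longlonglongrightarrow> e"
  note J [measurable]
  obtain r where r: "strict_mono r" "AE x in lebesgue. (\<lambda>k. rep_L2 (X (r k)) x) \<longlonglongrightarrow> rep_L2 u x"
    using L2_AE_limit_subseq[OF X(2)] .
  have H: "rep_L2 (X n) \<in> H_space J" for n using X(1) by (simp add: form_domain_def)
  have E0: "0 \<le> form_energy J (X n) (X n)" for n
    unfolding form_energy_def energy_eq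
    by (intro divide_nonneg_nonneg integral_nonneg_AE) (simp_all add: energy_density_nonneg[OF J])
  \<comment> \<open>\<open>ennreal\<close> truncates at 0, so the sign is needed to read the final
    bound back as one between reals.\<close>
  have e0: "0 \<le> e" by (rule LIMSEQ_le_const[OF e]) (use E0 in auto)
  have le: "(\<integral>\<^sup>+p. ennreal (energy_density J (rep_L2 u) (rep_L2 u) p) \<partial>lebesgue) \<le> ennreal (2 * e)"
  proof (rule nn_integral_le_limit)
    show "(\<lambda>p. ennreal (energy_density J (rep_L2 (X (r k))) (rep_L2 (X (r k))) p)) \<in> borel_measurable lebesgue" for k
      by measurable
    show "AE p in lebesgue. (\<lambda>k. ennreal (energy_density J (rep_L2 (X (r k))) (rep_L2 (X (r k))) p)) \<longlonglongrightarrow>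
        ennreal (energy_density J (rep_L2 u) (rep_L2 u) p)"
      using AE_lebesgue_fst_snd(1)[OF r(2)] AE_lebesgue_fst_snd(2)[OF r(2)]
      by eventually_elim (unfold energy_density_def, intro tendsto_intros)
    show "(\<integral>\<^sup>+p. ennreal (energy_density J (rep_L2 (X (r k))) (rep_L2 (X (r k))) p) \<partial>lebesgue)
        \<le> ennreal (2 * form_energy J (X (r k)) (X (r k)))" for k
      by (simp add: nn_integral_energy_density[OF J H] form_energy_def)
    show "(\<lambda>k. ennreal (2 * form_energy J (X (r k)) (X (r k)))) \<longlonglongrightarrow> ennreal (2 * e)"
      using LIMSEQ_subseq_LIMSEQ[OF e r(1)] by (intro tendsto_intros) (simp add: o_def)
  qed
  have "integrable lebesgue (energy_density J (rep_L2 u) (rep_L2 u))"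
    by (rule integrableI_nonneg)
      (use le in \<open>auto simp: energy_density_nonneg[OF J] less_top[symmetric] top_unique\<close>)
  then have uH: "rep_L2 u \<in> H_space J" by (simp add: H_space_iff)
  show "u \<in> form_domain J \<and> form_energy J u u \<le> e"
    using le uH e0 by (simp add: nn_integral_energy_density[OF J] form_domain_def form_energy_def)
qed

lemma levy_solution_of_classical:
  fixes J :: "'a::euclidean_space \<Rightarrow> 'a \<Rightarrow> real"
  assumes J: "levy_kernel J"
    and UV: "closed_form.classical_solution (form_domain J) (form_energy J) U V"
  shows "levy_solution J (rep_L2 (U 0)) (\<lambda>t. rep_L2 (U t))"
proof -
  interpret closed_form "form_domain J" "form_energy J" by (rule closed_form_levy[OF J])
  note J [measurable]
  have Lp: "Lp_norm 2 (\<lambda>x. rep_L2 a x - rep_L2 b x) = norm (a - b)" for a b :: "'a L2"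
    by (simp add: norm_L2_abs Lp_space_2_diff flip: abs_L2_diff_rep)
  have cU: "(U \<longlongrightarrow> U t) (at t within {0..})" and cV: "(V \<longlongrightarrow> V t) (at t within {0..})" if "0 \<le> t" for t
    using solution_continuous[OF UV] that by (auto simp: continuous_on)
  have sub: "at t within {0<..} \<le> at t within {0..}" for t :: real
    by (rule at_le) auto
  have cU': "(U \<longlongrightarrow> U t) (at t within {0<..})" and cV': "(V \<longlongrightarrow> V t) (at t within {0<..})" if "0 < t" for t
    using cU[of t] cV[of t] that by (auto intro: tendsto_mono[OF sub])
  have UD: "rep_L2 (U t) \<in> H_space J" if "0 \<le> t" for t
    using solution_D[OF UV that] by (simp add: form_domain_def)
  have op: "levy_op J (rep_L2 (U t)) (\<lambda>x. - rep_L2 (V t) x)" if t: "0 < t" for t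
    unfolding levy_op_def
  proof (intro conjI ballI)
    show "rep_L2 (U t) \<in> H_space J" using t by (simp add: UD)
    show "(\<lambda>x. - rep_L2 (V t) x) \<in> Lp_space 2" by (simp add: Lp_space_2_uminus)
    \<comment> \<open>Test functions are arbitrary elements of \<open>H_space J\<close>, while the
      form only knows chosen representatives; the class of \<open>g\<close> mediates.\<close>
    fix g assume g: "g \<in> H_space J"
    then have gL: "g \<in> Lp_space 2" by (simp add: H_space_iff)
    have gg: "AE x in lebesgue. g x = rep_L2 (abs_L2 g) x"
      using rep_abs_L2[OF gL] by eventually_elim simp
    have D: "abs_L2 g \<in> form_domain J"
      unfolding form_domain_def mem_Collect_eq by (rule H_space_cong_AE[OF J rep_L2_in gg g])
    have "(\<integral>x. - rep_L2 (V t) x * g x \<partial>lebesgue) = - (abs_L2 (rep_L2 (V t)) \<bullet> abs_L2 g)"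
      by (subst inner_L2_abs) (simp_all add: gL)
    also have "\<dots> = form_energy J (U t) (abs_L2 g)"
      using solution_E[OF UV, of t "abs_L2 g"] t D by simp
    also have "\<dots> = energy J (rep_L2 (U t)) g"
      unfolding form_energy_def using gg gL
      by (intro energy_cong_AE[OF J]) (auto intro: Lp_space_2_measurable AE_symmetric)
    finally show "(\<integral>x. - rep_L2 (V t) x * g x \<partial>lebesgue) = energy J (rep_L2 (U t)) g" .
  qed
  \<comment> \<open>The energy of \<open>U s - U t\<close> equals
    \<open>- ((V s - V t) \<bullet> (U s - U t))\<close>, so continuity in the form norm reduces to
    continuity of \<open>U\<close> and \<open>V\<close> in \<open>L2\<close>.\<close>
  have Hn: "((\<lambda>s. H_norm J (\<lambda>x. rep_L2 (U s) x - rep_L2 (U t) x)) \<longlongrightarrow> 0) (at t within {0<..})" if t: "0 < t" for t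
  proof (rule Lim_transform_eventually)
    have "((\<lambda>s. sqrt ((norm (U s - U t))\<^sup>2 + - ((V s - V t) \<bullet> (U s - U t)))) \<longlongrightarrow>
       sqrt ((norm (U t - U t))\<^sup>2 + - ((V t - V t) \<bullet> (U t - U t)))) (at t within {0<..})"
      by (intro tendsto_intros cU' cV' t)
    then show "((\<lambda>s. sqrt ((norm (U s - U t))\<^sup>2 + - ((V s - V t) \<bullet> (U s - U t)))) \<longlongrightarrow> 0) (at t within {0<..})"
      by simp
    show "\<forall>\<^sub>F s in at t within {0<..}. sqrt ((norm (U s - U t))\<^sup>2 + - ((V s - V t) \<bullet> (U s - U t))) =
        H_norm J (\<lambda>x. rep_L2 (U s) x - rep_L2 (U t) x)"
      unfolding eventually_at_filter
    proof (intro always_eventually allI impI)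
      fix s :: real assume "s \<in> {0<..}"
      then have s: "0 \<le> s" by simp
      have "energy J (\<lambda>x. rep_L2 (U s) x - rep_L2 (U t) x) (\<lambda>x. rep_L2 (U s) x - rep_L2 (U t) x) =
          form_energy J (U s - U t) (U s - U t)"
        unfolding form_energy_def using rep_L2_diff[of "U s" "U t"]
        by (intro energy_cong_AE[OF J]) (auto intro: AE_symmetric)
      also have "\<dots> = - ((V s - V t) \<bullet> (U s - U t))"
        using s t D_diff[OF solution_D[OF UV s] solution_D[OF UV, of t]]
        by (simp add: E_diff_left solution_D[OF UV] solution_E[OF UV] inner_diff_left)
      finally show "sqrt ((norm (U s - U t))\<^sup>2 + - ((V s - V t) \<bullet> (U s - U t))) =
        H_norm J (\<lambda>x. rep_L2 (U s) x - rep_L2 (U t) x)"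
        by (simp add: H_norm_def Lp)
    qed
  qed
  have dq: "((\<lambda>s. Lp_norm 2 (\<lambda>x. (rep_L2 (U s) x - rep_L2 (U t) x) / (s - t) - rep_L2 (V t) x)) \<longlongrightarrow> 0)
      (at t within {0<..})" if t: "0 < t" for t
  proof -
    have "Lp_norm 2 (\<lambda>x. (rep_L2 (U s) x - rep_L2 (U t) x) / (s - t) - rep_L2 (V t) x) =
        norm ((U s - U t) /\<^sub>R (s - t) - V t)" for s
    proof -
      have "AE x in lebesgue. (rep_L2 (U s) x - rep_L2 (U t) x) / (s - t) - rep_L2 (V t) x =
          rep_L2 ((U s - U t) /\<^sub>R (s - t) - V t) x"
        using rep_L2_diff[of "(U s - U t) /\<^sub>R (s - t)" "V t"] rep_L2_diff[of "U s" "U t"]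
          rep_L2_scale[of "inverse (s - t)" "U s - U t"]
        by eventually_elim (simp add: divide_inverse)
      then show ?thesis
        unfolding Lp_norm_2_rep[symmetric] by (rule Lp_norm_2_cong_AE[rotated 2]) measurable
    qed
    moreover have "((\<lambda>s. (U s - U t) /\<^sub>R (s - t)) \<longlongrightarrow> V t) (at t within {0<..})"
      by (rule has_vector_derivative_imp_tendsto[OF has_vector_derivative_at_within[OF solution_deriv[OF UV t]]])
    ultimately show ?thesis
      using tendsto_norm_zero[OF LIM_zero] by simp
  qed
  show ?thesis
    unfolding levy_solution_def
  proof (intro conjI allI impI exI[of _ "\<lambda>t. rep_L2 (V t)"])
    fix t :: real assume "0 \<le> t"
    then show "((\<lambda>s. Lp_norm 2 (\<lambda>x. rep_L2 (U s) x - rep_L2 (U t) x)) \<longlongrightarrow> 0) (at t within {0..})"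
      unfolding Lp by (intro tendsto_norm_zero LIM_zero cU)
  next
    fix t :: real assume t: "0 < t"
    then show "((\<lambda>s. Lp_norm 2 (\<lambda>x. rep_L2 (V s) x - rep_L2 (V t) x)) \<longlongrightarrow> 0) (at t within {0<..})"
      unfolding Lp by (intro tendsto_norm_zero LIM_zero cV')
  qed (simp_all add: UD op Hn dq)
qed

section \<open>Energy of bump functions\<close>

lemma emeasure_ball_eq:
  fixes x :: "'a::euclidean_space"
  assumes "0 \<le> r"
  shows "emeasure lborel (ball x r) = ennreal (r ^ DIM('a) * measure lborel (ball (0 :: 'a) 1))"
  using emeasure_lborel_ball_finite[of x r]
  by (subst emeasure_eq_ennreal_measure) (auto simp: content_ball_conv_unit_ball[OF assms])

lemma dyadic_scale_exists:
  fixes z :: real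
  assumes "0 < z" "z < 1"
  obtains k :: nat where "(1/2) ^ Suc k \<le> z" "z < (1/2) ^ k"
proof -
  obtain m :: nat where m: "(1/2) ^ m < z" using real_arch_pow_inv[of z "1/2"] assms by auto
  define k where "k = (LEAST k. (1/2) ^ Suc k \<le> z)"
  have "(1/2) ^ Suc m \<le> z" using m assms by simp
  then have 1: "(1/2) ^ Suc k \<le> z" unfolding k_def by (rule LeastI)
  have "z < (1/2) ^ k"
  proof (cases k)
    case 0
    then show ?thesis using assms by simp
  next
    case (Suc j)
    have "\<not> (1/2) ^ Suc j \<le> z"
      using not_less_Least[of j "\<lambda>k. (1/2) ^ Suc k \<le> z"] Suc unfolding k_def by auto
    then show ?thesis using Suc by simp
  qed
  with 1 show ?thesis by (rule that)
qed

text \<open>The \<open>n\<close> equal leading terms produce \<open>n\<close>, the geometric tail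
  produces \<open>4 / 3\<close>.\<close>

lemma min_geometric_sums:
  "(\<lambda>k. min ((1/4) ^ n) ((1/4) ^ k) :: real) sums ((1/4) ^ n * (4 / 3 + real n))"
proof -
  have "(\<lambda>k. (1/4) ^ n * (1/4) ^ k :: real) sums ((1/4) ^ n * (4 / 3))"
    using sums_mult[OF geometric_sums[of "1/4 :: real"], of "(1/4) ^ n"] by simp
  moreover have "min ((1/4) ^ n) ((1/4) ^ (k + n)) = (1/4) ^ n * (1/4 :: real) ^ k" for k
  proof -
    have "(1/4) ^ (k + n) \<le> (1/4 :: real) ^ n" by (intro power_decreasing) auto
    then show ?thesis by (simp only: min_absorb2) (simp add: power_add)
  qed
  ultimately have "(\<lambda>k. min ((1/4) ^ n) ((1/4) ^ (k + n)) :: real) sums ((1/4) ^ n * (4 / 3))"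
    by (simp only:)
  then have "(\<lambda>k. min ((1/4) ^ n) ((1/4) ^ k) :: real) sums ((1/4) ^ n * (4 / 3) + (\<Sum>k<n. min ((1/4) ^ n) ((1/4) ^ k)))"
    by (subst (asm) sums_iff_shift)
  also have "(\<Sum>k<n. min ((1/4) ^ n) ((1/4) ^ k)) = (\<Sum>k<n. (1/4) ^ n :: real)"
    by (intro sum.cong refl min_absorb1 power_decreasing) auto
  finally show ?thesis by (simp add: algebra_simps)
qed

text \<open>The bound on \<open>J\<close> near the diagonal is summed over the dyadic shells
  \<open>2\<^sup>-\<^sup>k\<^sup>-\<^sup>1 \<le> norm (x - y) < 2\<^sup>-\<^sup>k\<close>, each of which contributes the same amount as long as
  \<open>k < n\<close>; this is the source of the factor \<open>n\<close>.\<close>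

lemma kernel_section_bound:
  fixes x :: "'a::euclidean_space"
  assumes [measurable]: "j \<in> borel_measurable borel"
    and j0: "\<And>y. 0 \<le> j y" and c: "0 < c" and K: "0 \<le> K"
    and near: "AE y in lborel. 0 < norm (x - y) \<longrightarrow> norm (x - y) < 1 \<longrightarrow> j y \<le> c * norm (x - y) powr (- real DIM('a))"
    and far: "(\<integral>\<^sup>+y. ennreal (j y * min 1 ((norm (x - y))\<^sup>2)) \<partial>lborel) \<le> ennreal K"
  shows "(\<integral>\<^sup>+y. ennreal ((min ((1/2) ^ n) (norm (x - y)))\<^sup>2 * j y) \<partial>lborel)
    \<le> ennreal ((1/4) ^ n * (1 + real n) * (2 * c * 2 ^ DIM('a) * measure lborel (ball (0 :: 'a) 1) + K))"
proof -
  define N where "N = DIM('a)"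
  define \<omega> where "\<omega> = measure lborel (ball (0 :: 'a) 1)"
  have \<omega>: "0 \<le> \<omega>" by (simp add: \<omega>_def)
  \<comment> \<open>The largest value of the integrand on the shell of index \<open>k\<close>: there
    the distance is at least \<open>(1/2) ^ Suc k\<close>, which bounds \<open>j\<close>, and less
    than \<open>(1/2) ^ k\<close>, which bounds the squared minimum.\<close>
  define a where "a k = c * min ((1/4) ^ n) ((1/4) ^ k) * (2 ^ Suc k) ^ N" for k :: nat
  have a0: "0 \<le> a k" for k using c by (simp add: a_def)
  \<comment> \<open>Each shell is enlarged to the ball containing it; the volume of that ball
    cancels the growth of \<open>j\<close> up to a factor \<open>2 ^ N\<close>.\<close>
  define g where "g y = (\<Sum>k. ennreal (a k) * indicator (ball x ((1/2) ^ k)) y)" for y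
  have sq: "((1/2) ^ n)\<^sup>2 = (1/4 :: real) ^ n" for n
    by (simp add: power2_eq_square power_mult_distrib[symmetric])
  have pw: "AE y in lborel. ennreal ((min ((1/2) ^ n) (norm (x - y)))\<^sup>2 * j y)
      \<le> g y + ennreal ((1/4) ^ n) * ennreal (j y * min 1 ((norm (x - y))\<^sup>2))"
    using near
  proof eventually_elim
    case (elim y)
    define z where "z = norm (x - y)"
    consider "z = 0" | "0 < z" "z < 1" | "1 \<le> z" unfolding z_def by force
    then have "ennreal ((min ((1/2) ^ n) z)\<^sup>2 * j y) \<le> g y + ennreal ((1/4) ^ n) * ennreal (j y * min 1 (z\<^sup>2))"
    proof cases
      case 1
      then show ?thesis by (simp add: min_absorb2)
    next
      case 2
      obtain k where k: "(1/2) ^ Suc k \<le> z" "z < (1/2) ^ k" using dyadic_scale_exists[OF 2] .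
      have "(min ((1/2) ^ n) z)\<^sup>2 \<le> min ((1/4) ^ n) ((1/4) ^ k)"
      proof -
        have "(min ((1/2) ^ n) z)\<^sup>2 \<le> ((1/2) ^ n)\<^sup>2" "(min ((1/2) ^ n) z)\<^sup>2 \<le> ((1/2) ^ k)\<^sup>2"
          using k 2 by (intro power_mono; simp)+
        then show ?thesis by (simp add: sq)
      qed
      moreover have "j y \<le> c * (2 ^ Suc k) ^ N"
      proof -
        have "j y \<le> c * z powr (- real N)" using elim 2 by (simp add: z_def N_def)
        also have "z powr (- real N) = inverse z ^ N"
          using 2 by (simp add: powr_minus powr_realpow power_inverse)
        also have "\<dots> \<le> (2 ^ Suc k) ^ N"
        proof (rule power_mono)
          have "inverse z \<le> inverse ((1/2) ^ Suc k)" using k by (intro le_imp_inverse_le) auto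
          then show "inverse z \<le> 2 ^ Suc k" by (simp add: power_one_over)
        qed (use 2 in simp)
        finally show ?thesis using c by simp
      qed
      ultimately have "(min ((1/2) ^ n) z)\<^sup>2 * j y \<le> min ((1/4) ^ n) ((1/4) ^ k) * (c * (2 ^ Suc k) ^ N)"
        using j0 by (intro mult_mono) auto
      also have "\<dots> = a k" by (simp add: a_def)
      finally have "ennreal ((min ((1/2) ^ n) z)\<^sup>2 * j y) \<le> ennreal (a k) * indicator (ball x ((1/2) ^ k)) y"
        using k by (simp add: z_def dist_norm ennreal_leI)
      also have "\<dots> \<le> g y"
      proof -
        define F where "F k = ennreal (a k) * indicator (ball x ((1/2) ^ k)) y" for k
        have "F k \<le> suminf F"
          using sum_le_suminf[of F "{k}"] by simp
        then show ?thesis by (simp add: g_def F_def[abs_def])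
      qed
      finally show ?thesis by (simp add: add_increasing2)
    next
      case 3
      have "(min ((1/2) ^ n) z)\<^sup>2 \<le> (1/4) ^ n"
        unfolding sq[symmetric] using 3 by (intro power_mono) auto
      then have "(min ((1/2) ^ n) z)\<^sup>2 * j y \<le> (1/4) ^ n * (j y * min 1 (z\<^sup>2))"
        using 3 j0 by (simp add: min_absorb1 mult_right_mono)
      then show ?thesis
        by (intro add_increasing) (auto simp: ennreal_mult[symmetric] j0 intro!: ennreal_leI)
    qed
    then show ?case by (simp add: z_def)
  qed
  have ball_meas: "(\<lambda>y. ennreal (a k) * indicator (ball x ((1/2) ^ k)) y) \<in> borel_measurable borel" for k
    by (intro borel_measurable_times_ennreal borel_measurable_const borel_measurable_indicator) simp
  then have [measurable]: "g \<in> borel_measurable borel"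
    unfolding g_def[abs_def] by (intro borel_measurable_suminf_order)
  have g_int: "(\<integral>\<^sup>+y. g y \<partial>lborel) = ennreal (c * 2 ^ N * \<omega> * ((1/4) ^ n * (4 / 3 + real n)))"
  proof -
    have "(\<integral>\<^sup>+y. g y \<partial>lborel) = (\<Sum>k. ennreal (a k) * emeasure lborel (ball x ((1/2) ^ k)))"
      unfolding g_def by (subst nn_integral_suminf) (simp_all add: nn_integral_cmult_indicator ball_meas)
    also have "\<dots> = (\<Sum>k. ennreal (c * 2 ^ N * \<omega> * min ((1/4) ^ n) ((1/4) ^ k)))"
    proof (rule suminf_cong)
      fix k
      have "(2 ^ Suc k) ^ N * ((1/2) ^ k) ^ N = (2 ^ N :: real)"
        unfolding power_mult_distrib[symmetric] by (simp add: power_one_over)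
      moreover have "a k * (((1/2) ^ k) ^ N * \<omega>) =
          c * ((2 ^ Suc k) ^ N * ((1/2) ^ k) ^ N) * \<omega> * min ((1/4) ^ n) ((1/4) ^ k)"
        unfolding a_def by (simp only: mult_ac)
      ultimately have eq: "a k * (((1/2) ^ k) ^ N * \<omega>) = c * 2 ^ N * \<omega> * min ((1/4) ^ n) ((1/4) ^ k)"
        by (simp only:)
      have "ennreal (a k) * emeasure lborel (ball x ((1/2) ^ k)) = ennreal (a k * (((1/2) ^ k) ^ N * \<omega>))"
        using a0 \<omega> by (simp add: emeasure_ball_eq ennreal_mult flip: N_def \<omega>_def)
      then show "ennreal (a k) * emeasure lborel (ball x ((1/2) ^ k)) = ennreal (c * 2 ^ N * \<omega> * min ((1/4) ^ n) ((1/4) ^ k))"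
        by (simp only: eq)
    qed
    also have "\<dots> = ennreal (c * 2 ^ N * \<omega> * ((1/4) ^ n * (4 / 3 + real n)))"
      using c \<omega> by (intro suminf_ennreal_eq sums_mult min_geometric_sums) auto
    finally show ?thesis .
  qed
  have "(\<integral>\<^sup>+y. ennreal ((min ((1/2) ^ n) (norm (x - y)))\<^sup>2 * j y) \<partial>lborel)
    \<le> (\<integral>\<^sup>+y. g y + ennreal ((1/4) ^ n) * ennreal (j y * min 1 ((norm (x - y))\<^sup>2)) \<partial>lborel)"
    by (rule nn_integral_mono_AE[OF pw])
  also have "\<dots> = (\<integral>\<^sup>+y. g y \<partial>lborel) + ennreal ((1/4) ^ n) * (\<integral>\<^sup>+y. ennreal (j y * min 1 ((norm (x - y))\<^sup>2)) \<partial>lborel)"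
    by (subst nn_integral_add) (simp_all add: nn_integral_cmult)
  also have "\<dots> \<le> ennreal (c * 2 ^ N * \<omega> * ((1/4) ^ n * (4 / 3 + real n))) + ennreal ((1/4) ^ n) * ennreal K"
    unfolding g_int by (intro add_left_mono mult_left_mono far) simp
  also have "\<dots> = ennreal (c * 2 ^ N * \<omega> * ((1/4) ^ n * (4 / 3 + real n)) + (1/4) ^ n * K)"
    using c \<omega> K by (simp add: ennreal_mult[symmetric] ennreal_plus[symmetric] del: ennreal_plus)
  also have "\<dots> \<le> ennreal ((1/4) ^ n * (1 + real n) * (2 * c * 2 ^ N * \<omega> + K))"
  proof (rule ennreal_leI)
    \<comment> \<open>Both \<open>4 / 3 + n \<le> 2 * (1 + n)\<close> and
      \<open>1 \<le> 1 + n\<close> are used, to pull out a common factor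
      \<open>1 + n\<close>.\<close>
    have "(1/4) ^ n * (c * 2 ^ N * \<omega> * (4 / 3 + real n) + K) \<le> (1/4) ^ n * (c * 2 ^ N * \<omega> * (2 * (1 + real n)) + (1 + real n) * K)"
      using c \<omega> K by (intro mult_left_mono add_mono) (auto simp: algebra_simps)
    then show "c * 2 ^ N * \<omega> * ((1/4) ^ n * (4 / 3 + real n)) + (1/4) ^ n * K
        \<le> (1/4) ^ n * (1 + real n) * (2 * c * 2 ^ N * \<omega> + K)"
      by (simp add: algebra_simps)
  qed
  finally show ?thesis by (simp add: N_def \<omega>_def)
qed

section \<open>Cones of slope one and their Rayleigh quotients\<close>

definition bump :: "nat \<Rightarrow> 'a::euclidean_space \<Rightarrow> real" where
  "bump n x = max 0 ((1/2) ^ n - norm x)"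

lemma bump_measurable [measurable]: "bump n \<in> borel_measurable borel"
  unfolding bump_def[abs_def] by measurable

lemma bump_bounds: "0 \<le> bump n x" "bump n x \<le> (1/2) ^ n"
  by (auto simp: bump_def)

lemma bump_eq_0: "x \<notin> ball 0 ((1/2) ^ n) \<Longrightarrow> bump n x = 0"
  by (simp add: bump_def)

text \<open>Slope one gives the distance, the height gives \<open>(1/2) ^ n\<close>. The minimum of
  the two is the weight against which kernel sections are integrated.\<close>

lemma bump_diff_le: "\<bar>bump n x - bump n y\<bar> \<le> min ((1/2) ^ n) (norm (x - y))"
proof -
  have "\<bar>norm x - norm y\<bar> \<le> norm (x - y)" by (rule norm_triangle_ineq3)
  moreover have "\<bar>bump n x - bump n y\<bar> \<le> \<bar>norm x - norm y\<bar>" by (auto simp: bump_def)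
  ultimately show ?thesis using bump_bounds[of n x] bump_bounds[of n y] by auto
qed

lemma bump_measurable_lebesgue [measurable]: "bump n \<in> borel_measurable lebesgue"
  using bump_measurable by (intro measurable_completion) simp

lemma indicator_ball_L2: "indicator (ball (0 :: 'a::euclidean_space) r) \<in> Lp_space 2"
proof -
  have "(\<lambda>x::'a. (indicator (ball 0 r) x :: real)\<^sup>2) = indicator (ball 0 r)"
    by (auto simp: indicator_def)
  then show ?thesis
    using emeasure_lborel_ball_finite[of "0::'a" r] by (auto simp: Lp_space_2_iff intro!: borel_measurable_indicator)
qed

lemma bump_L2: "(bump n :: 'a::euclidean_space \<Rightarrow> real) \<in> Lp_space 2"
  unfolding Lp_space_2_iff
proof
  show "integrable lebesgue (\<lambda>x::'a. (bump n x)\<^sup>2)"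
  proof (rule Bochner_Integration.integrable_bound)
    show "integrable lebesgue (\<lambda>x::'a. (indicator (ball 0 ((1/2) ^ n)) x)\<^sup>2 :: real)"
      using indicator_ball_L2[of "(1/2) ^ n", where 'a='a] by (simp add: Lp_space_2_iff)
    have "(bump n x)\<^sup>2 \<le> (indicator (ball 0 ((1/2) ^ n)) x)\<^sup>2" for x :: 'a
    proof (rule power_mono)
      have "bump n x \<le> 1" using bump_bounds(2)[of n x] power_le_one[of "1/2::real" n] by linarith
      then show "bump n x \<le> indicator (ball 0 ((1/2) ^ n)) x"
        using bump_eq_0[of x n] by (auto simp: indicator_def)
    qed (rule bump_bounds)
    then show "AE x in lebesgue. norm ((bump n x)\<^sup>2) \<le> norm ((indicator (ball 0 ((1/2) ^ n)) (x::'a))\<^sup>2 :: real)"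
      by simp
  qed measurable
qed measurable

text \<open>On the concentric ball of half the radius the bump has at least half its height.\<close>

lemma bump_norm_lower:
  "(1/4) ^ Suc n * (((1/2) ^ Suc n) ^ DIM('a) * measure lborel (ball (0 :: 'a) 1)) \<le> (\<integral>x. (bump n (x :: 'a::euclidean_space))\<^sup>2 \<partial>lebesgue)"
proof -
  have "(1/4) ^ Suc n * measure lborel (ball (0 :: 'a) ((1/2) ^ Suc n)) =
      (\<integral>x. (1/4) ^ Suc n * indicator (ball (0 :: 'a) ((1/2) ^ Suc n)) x \<partial>lebesgue)"
    by simp
  also have "\<dots> \<le> (\<integral>x. (bump n (x :: 'a))\<^sup>2 \<partial>lebesgue)"
  proof (rule integral_mono)
    show "integrable lebesgue (\<lambda>x. (1/4) ^ Suc n * indicator (ball (0 :: 'a) ((1/2) ^ Suc n)) x :: real)"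
      using emeasure_lborel_ball_finite[of "0::'a" "(1/2) ^ Suc n"] by simp
    show "integrable lebesgue (\<lambda>x::'a. (bump n x)\<^sup>2)" using bump_L2 Lp_space_2_iff by blast
    fix x :: 'a
    show "(1/4) ^ Suc n * indicator (ball (0 :: 'a) ((1/2) ^ Suc n)) x \<le> (bump n x)\<^sup>2"
    proof (cases "x \<in> ball 0 ((1/2) ^ Suc n)")
      case True
      then have "(1/2) ^ Suc n \<le> (1/2) ^ n - norm x" by simp
      also have "\<dots> \<le> bump n x" by (simp add: bump_def)
      finally have "(1/2) ^ Suc n \<le> bump n x" .
      then have "((1/2) ^ Suc n)\<^sup>2 \<le> (bump n x)\<^sup>2" by (intro power_mono) auto
      also have "((1/2) ^ Suc n)\<^sup>2 = (1/4 :: real) ^ Suc n"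
        unfolding power2_eq_square power_mult_distrib[symmetric] by simp
      finally show ?thesis using True by simp
    qed simp
  qed
  finally show ?thesis by (simp add: content_ball_conv_unit_ball[of "(1/2) ^ Suc n"] del: power_Suc)
qed

text \<open>The density vanishes unless one of the points lies in the support. Splitting by that
  point allows integrating first over the other one, where the section bound is uniform.\<close>

lemma bump_energy_density_le:
  assumes J: "levy_kernel J"
  shows "ennreal (energy_density J (bump n) (bump n) (x, y)) \<le>
    indicator (ball 0 ((1/2) ^ n)) x * ennreal ((min ((1/2) ^ n) (norm (x - y)))\<^sup>2 * J x y) +
    indicator (ball 0 ((1/2) ^ n)) y * ennreal ((min ((1/2) ^ n) (norm (x - y)))\<^sup>2 * J x y)"
    (is "_ \<le> ?i x * ?h + ?i y * ?h")
proof (cases "x \<in> ball 0 ((1/2) ^ n) \<or> y \<in> ball 0 ((1/2) ^ n)")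
  case True
  have "(bump n x - bump n y) * (bump n x - bump n y) \<le> (min ((1/2) ^ n) (norm (x - y)))\<^sup>2"
    using power_mono[OF bump_diff_le[of n x y], of 2] by (simp add: power2_eq_square)
  then have "ennreal (energy_density J (bump n) (bump n) (x, y)) \<le> ?h"
    unfolding energy_density_def
    by (intro ennreal_leI) (simp add: mult_right_mono levy_kernel_nonneg[OF J])
  also have "?h \<le> ?i x * ?h + ?i y * ?h"
    using True by (auto simp: indicator_def add_increasing add_increasing2)
  finally show ?thesis .
next
  case False
  then show ?thesis by (simp add: energy_density_def bump_eq_0)
qed

lemma levy_kernel_bound:
  fixes J :: "'a::euclidean_space \<Rightarrow> 'a \<Rightarrow> real"
  assumes "levy_kernel J"
  obtains K where "0 \<le> K" "\<And>x. (\<integral>\<^sup>+y. ennreal (J x y * min 1 ((norm (x - y))\<^sup>2)) \<partial>lborel) \<le> ennreal K"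
proof -
  define S where "S = (SUP x. \<integral>\<^sup>+ y. ennreal (J x y * min 1 ((norm (x - y))\<^sup>2)) \<partial>lebesgue)"
  have "S < \<infinity>" using assms by (simp add: levy_kernel_def S_def)
  then have "S = ennreal (enn2real S)" by simp
  moreover have "(\<integral>\<^sup>+y. ennreal (J x y * min 1 ((norm (x - y))\<^sup>2)) \<partial>lborel) \<le> S" for x
    unfolding S_def nn_integral_completion by (rule SUP_upper) simp
  ultimately show ?thesis by (intro that[of "enn2real S"]) auto
qed

text \<open>Only almost every section of \<open>J\<close> is measurable, so \<open>J\<close> is replaced by a Borel version
  before Tonelli's theorem is applied.\<close>

lemma bump_energy_nn_integral:
  fixes J :: "'a::euclidean_space \<Rightarrow> 'a \<Rightarrow> real"
  assumes J: "levy_kernel J" and c: "0 < c"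
    and near: "\<And>x y. 0 < norm (x - y) \<Longrightarrow> norm (x - y) < 1 \<Longrightarrow> J x y \<le> c * norm (x - y) powr (- real DIM('a))"
    and K: "0 \<le> K" "\<And>x. (\<integral>\<^sup>+y. ennreal (J x y * min 1 ((norm (x - y))\<^sup>2)) \<partial>lborel) \<le> ennreal K"
  shows "(\<integral>\<^sup>+p. ennreal (energy_density J (bump n) (bump n) p) \<partial>lebesgue) \<le>
    2 * (ennreal ((1/4) ^ n * (1 + real n) * (2 * c * 2 ^ DIM('a) * measure lborel (ball (0 :: 'a) 1) + K)) *
      emeasure lborel (ball (0 :: 'a) ((1/2) ^ n)))"
proof -
  define M where "M = ennreal ((1/4) ^ n * (1 + real n) * (2 * c * 2 ^ DIM('a) * measure lborel (ball (0 :: 'a) 1) + K))"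
  let ?B = "ball (0 :: 'a) ((1/2) ^ n)"
  obtain J0 where J0 [measurable]: "J0 \<in> borel_measurable (lborel :: ('a \<times> 'a) measure)"
    and ae0: "AE p in lborel. J (fst p) (snd p) = J0 p"
    using completion_ex_borel_measurable_real[OF levy_kernel_measurable[OF J]] by blast
  \<comment> \<open>Truncation makes every section nonnegative; as \<open>J\<close> is nonnegative,
    the two still agree almost everywhere.\<close>
  define J' where "J' p = max 0 (J0 p)" for p
  have J'_borel: "J' \<in> borel_measurable (lborel \<Otimes>\<^sub>M lborel)"
    unfolding J'_def[abs_def] lborel_prod by measurable
  note J'_borel [measurable]
  have J'0: "0 \<le> J' p" for p by (simp add: J'_def)
  have ae: "AE p in lborel \<Otimes>\<^sub>M lborel. J (fst p) (snd p) = J' p"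
    unfolding lborel_prod using ae0 by eventually_elim (metis J'_def levy_kernel_nonneg[OF J] max.absorb2)
  define h where "h p = ennreal ((min ((1/2) ^ n) (norm (fst p - snd p)))\<^sup>2 * J' p)" for p
  have h [measurable]: "h \<in> borel_measurable (lborel \<Otimes>\<^sub>M lborel)"
    unfolding h_def[abs_def] by measurable
  have "indicator ?B \<in> borel_measurable (lborel :: 'a measure)"
    by (rule borel_measurable_indicator) simp
  then have meas: "(\<lambda>p. indicator ?B (fst p) * h p) \<in> borel_measurable (lborel \<Otimes>\<^sub>M lborel)"
    "(\<lambda>p. indicator ?B (snd p) * h p) \<in> borel_measurable (lborel \<Otimes>\<^sub>M lborel)"
    by (intro borel_measurable_times_ennreal h measurable_compose[OF measurable_fst] measurable_compose[OF measurable_snd]; assumption)+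
  \<comment> \<open>Formulated for any Borel \<open>j\<close> that agrees almost everywhere with a
    section of \<open>J\<close>, so that it serves sections in either variable.\<close>
  have sect: "(\<integral>\<^sup>+y. ennreal ((min ((1/2) ^ n) (norm (x - y)))\<^sup>2 * j y) \<partial>lborel) \<le> M"
    if [measurable]: "j \<in> borel_measurable borel" and j0: "\<And>y. 0 \<le> j y" and eq: "AE y in lborel. J x y = j y" for x j
    unfolding M_def
  proof (rule kernel_section_bound[OF that(1) j0 c K(1)])
    show "AE y in lborel. 0 < norm (x - y) \<longrightarrow> norm (x - y) < 1 \<longrightarrow> j y \<le> c * norm (x - y) powr (- real DIM('a))"
      using eq by eventually_elim (metis near)
    have "(\<integral>\<^sup>+y. ennreal (j y * min 1 ((norm (x - y))\<^sup>2)) \<partial>lborel) = (\<integral>\<^sup>+y. ennreal (J x y * min 1 ((norm (x - y))\<^sup>2)) \<partial>lborel)"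
      by (rule nn_integral_cong_AE) (use eq in eventually_elim, simp)
    then show "(\<integral>\<^sup>+y. ennreal (j y * min 1 ((norm (x - y))\<^sup>2)) \<partial>lborel) \<le> ennreal K" using K(2)[of x] by simp
  qed
  have sec1: "AE x in lborel. (\<integral>\<^sup>+y. h (x, y) \<partial>lborel) \<le> M"
    using lborel_pair.AE_pair[OF ae]
  proof eventually_elim
    case (elim x)
    have "(\<lambda>y. J' (x, y)) \<in> borel_measurable borel"
      using measurable_compose[OF measurable_Pair1' J'_borel, of x] by simp
    from sect[OF this J'0, of x] elim show ?case by (simp add: h_def)
  qed
  \<comment> \<open>The Borel version need not be symmetric. Sections in the other variable are
    compared with \<open>J\<close> on the reflected product, and then the symmetry of
    \<open>J\<close> is used.\<close>
  have swap: "AE p in distr (lborel \<Otimes>\<^sub>M lborel) (lborel \<Otimes>\<^sub>M lborel) (\<lambda>(x :: 'a, y :: 'a). (y, x)). J (fst p) (snd p) = J' p"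
    using ae by (subst lborel_pair.distr_pair_swap[symmetric])
  have "AE p in lborel \<Otimes>\<^sub>M lborel. J (snd p) (fst p) = J' (snd p, fst p)"
    using AE_distrD[OF measurable_pair_swap' swap] by (simp add: case_prod_beta')
  from lborel_pair.AE_pair[OF this]
  have sec2: "AE y in lborel. (\<integral>\<^sup>+x. h (x, y) \<partial>lborel) \<le> M"
  proof eventually_elim
    case (elim y)
    have "(\<lambda>x. J' (x, y)) \<in> borel_measurable borel"
      using measurable_compose[OF measurable_Pair2' J'_borel, of y] by simp
    moreover have "AE x in lborel. J y x = J' (x, y)"
      using elim by eventually_elim (use J in \<open>simp add: levy_kernel_def\<close>)
    ultimately show ?case
      using sect[of "\<lambda>x. J' (x, y)" y] J'0 by (simp add: h_def norm_minus_commute)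
  qed
  have ind: "(\<integral>\<^sup>+x. M * indicator ?B x \<partial>lborel) = M * emeasure lborel ?B"
    by (rule nn_integral_cmult_indicator) simp
  have "(\<integral>\<^sup>+p. indicator ?B (fst p) * h p \<partial>(lborel \<Otimes>\<^sub>M lborel)) = (\<integral>\<^sup>+x. \<integral>\<^sup>+y. indicator ?B x * h (x, y) \<partial>lborel \<partial>lborel)"
    by (subst lborel.nn_integral_fst[OF meas(1), symmetric]) simp
  also have "\<dots> \<le> (\<integral>\<^sup>+x. M * indicator ?B x \<partial>lborel)"
    by (rule nn_integral_mono_AE) (use sec1 in eventually_elim, auto simp: indicator_def)
  finally have 1: "(\<integral>\<^sup>+p. indicator ?B (fst p) * h p \<partial>(lborel \<Otimes>\<^sub>M lborel)) \<le> M * emeasure lborel ?B"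
    unfolding ind .
  have "(\<integral>\<^sup>+p. indicator ?B (snd p) * h p \<partial>(lborel \<Otimes>\<^sub>M lborel)) = (\<integral>\<^sup>+y. \<integral>\<^sup>+x. indicator ?B y * h (x, y) \<partial>lborel \<partial>lborel)"
    by (subst lborel_pair.nn_integral_snd[OF meas(2), symmetric]) simp
  also have "\<dots> \<le> (\<integral>\<^sup>+x. M * indicator ?B x \<partial>lborel)"
    by (rule nn_integral_mono_AE) (use sec2 in eventually_elim, auto simp: indicator_def)
  finally have 2: "(\<integral>\<^sup>+p. indicator ?B (snd p) * h p \<partial>(lborel \<Otimes>\<^sub>M lborel)) \<le> M * emeasure lborel ?B"
    unfolding ind .
  have "(\<integral>\<^sup>+p. ennreal (energy_density J (bump n) (bump n) p) \<partial>lebesgue) =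
      (\<integral>\<^sup>+p. ennreal (energy_density J (bump n) (bump n) p) \<partial>(lborel \<Otimes>\<^sub>M lborel))"
    by (simp add: nn_integral_completion lborel_prod)
  also have "\<dots> \<le> (\<integral>\<^sup>+p. indicator ?B (fst p) * h p + indicator ?B (snd p) * h p \<partial>(lborel \<Otimes>\<^sub>M lborel))"
  proof (rule nn_integral_mono_AE)
    show "AE p in lborel \<Otimes>\<^sub>M lborel. ennreal (energy_density J (bump n) (bump n) p) \<le> indicator ?B (fst p) * h p + indicator ?B (snd p) * h p"
      using ae
    proof eventually_elim
      case (elim p)
      then show ?case
        using bump_energy_density_le[OF J, of n "fst p" "snd p"] by (simp add: h_def)
    qed
  qed
  also have "\<dots> = (\<integral>\<^sup>+p. indicator ?B (fst p) * h p \<partial>(lborel \<Otimes>\<^sub>M lborel)) + (\<integral>\<^sup>+p. indicator ?B (snd p) * h p \<partial>(lborel \<Otimes>\<^sub>M lborel))"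
    by (rule nn_integral_add) (rule meas)+
  also have "\<dots> \<le> M * emeasure lborel ?B + M * emeasure lborel ?B"
    by (rule add_mono[OF 1 2])
  finally show ?thesis unfolding M_def mult_2[of "_ :: ennreal"] .
qed

lemma bump_energy_bound:
  fixes J :: "'a::euclidean_space \<Rightarrow> 'a \<Rightarrow> real"
  assumes J: "levy_kernel J" and c: "0 < c"
    and near: "\<And>x y. 0 < norm (x - y) \<Longrightarrow> norm (x - y) < 1 \<Longrightarrow> J x y \<le> c * norm (x - y) powr (- real DIM('a))"
  obtains C where "0 < C" "\<And>n. bump n \<in> H_space J"
    "\<And>n. energy J (bump n) (bump n) \<le> C * (1 + real n) * (\<integral>x. (bump n (x :: 'a))\<^sup>2 \<partial>lebesgue)"
proof -
  obtain K where K: "0 \<le> K" "\<And>x. (\<integral>\<^sup>+y. ennreal (J x y * min 1 ((norm (x - y))\<^sup>2)) \<partial>lborel) \<le> ennreal K"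
    using levy_kernel_bound[OF J] by blast
  define \<omega> where "\<omega> = measure lborel (ball (0 :: 'a) 1)"
  define N where "N = DIM('a)"
  define M where "M = 2 * c * 2 ^ N * \<omega> + K"
  have \<omega>: "0 < \<omega>" unfolding \<omega>_def by (rule content_ball_pos) simp
  have M: "0 < M" using c \<omega> K by (simp add: M_def add_pos_nonneg)
  define e where "e n = (1/4) ^ n * (1 + real n) * M * (((1/2) ^ n) ^ N * \<omega>)" for n :: nat
  have e0: "0 \<le> e n" for n using M \<omega> by (simp add: e_def)
  have le: "(\<integral>\<^sup>+p. ennreal (energy_density J (bump n) (bump n) p) \<partial>lebesgue) \<le> ennreal (2 * e n)" for n
  proof -
    have "(\<integral>\<^sup>+p. ennreal (energy_density J (bump n) (bump n) p) \<partial>lebesgue) \<le>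
      2 * (ennreal ((1/4) ^ n * (1 + real n) * M) * ennreal (((1/2) ^ n) ^ N * \<omega>))"
      using bump_energy_nn_integral[OF J c near K, of n]
      by (simp add: emeasure_ball_eq M_def N_def \<omega>_def)
    also have "\<dots> = ennreal (2 * e n)"
      using M \<omega> by (simp add: e_def ennreal_mult)
    finally show ?thesis .
  qed
  have H: "bump n \<in> H_space J" for n
    unfolding H_space_iff
  proof
    show "integrable lebesgue (energy_density J (bump n) (bump n))"
    proof (rule integrableI_nonneg)
      show "energy_density J (bump n) (bump n) \<in> borel_measurable lebesgue"
        by (rule energy_density_measurable[OF J]) measurable
    qed (use le[of n] in \<open>auto simp: energy_density_nonneg[OF J] less_top[symmetric] top_unique\<close>)
  qed (rule bump_L2)
  have "energy J (bump n) (bump n) \<le> (4 * 2 ^ N * M) * (1 + real n) * (\<integral>x. (bump n (x :: 'a))\<^sup>2 \<partial>lebesgue)" for n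
  proof -
    have "energy J (bump n) (bump n) \<le> e n"
      using le[of n] e0[of n] by (simp add: nn_integral_energy_density[OF J H])
    \<comment> \<open>The norm bound lives on the half-radius ball; passing from \<open>n\<close> to
      \<open>Suc n\<close> costs 4 for the height and \<open>2 ^ N\<close> for the volume.\<close>
    also have "e n = (4 * 2 ^ N * M) * (1 + real n) * ((1/4) ^ Suc n * (((1/2) ^ Suc n) ^ N * \<omega>))"
      by (simp add: e_def power_mult_distrib power_one_over)
    also have "\<dots> \<le> (4 * 2 ^ N * M) * (1 + real n) * (\<integral>x. (bump n (x :: 'a))\<^sup>2 \<partial>lebesgue)"
      using M bump_norm_lower[of n, where 'a='a] by (intro mult_left_mono) (auto simp: N_def \<omega>_def)
    finally show ?thesis .
  qed
  then show ?thesis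
    using M H by (intro that[of "4 * 2 ^ N * M"]) auto
qed

section \<open>Pairing with a bump through the \<open>L^4\<close> norm\<close>

lemma Lp_norm_2_Cauchy_Schwarz:
  assumes "f \<in> Lp_space 2" "g \<in> Lp_space 2"
  shows "(\<integral>x. f x * g x \<partial>lebesgue) \<le> Lp_norm 2 f * Lp_norm 2 g"
  using norm_cauchy_schwarz[of "abs_L2 f" "abs_L2 g"] assms
  by (simp add: inner_L2_abs norm_L2_abs)

lemma power2_power2: "(a\<^sup>2)\<^sup>2 = (a :: 'a::monoid_mult) ^ 4"
  using power_mult[of a 2 2] by simp

lemma Lp_norm_4_eq: "Lp_norm 4 w = sqrt (Lp_norm 2 (\<lambda>x. (w x)\<^sup>2))"
proof -
  have "\<bar>w x\<bar> powr 4 = ((w x)\<^sup>2)\<^sup>2" for x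
    unfolding power2_power2 by simp
  then have "Lp_norm 4 w = (\<integral>x. ((w x)\<^sup>2)\<^sup>2 \<partial>lebesgue) powr (1 / 4)"
    by (simp only: Lp_norm_def)
  also have "1 / 4 = 1 / 2 * (1 / 2 :: real)" by simp
  also have "(\<integral>x. ((w x)\<^sup>2)\<^sup>2 \<partial>lebesgue) powr (1 / 2 * (1 / 2)) = ((\<integral>x. ((w x)\<^sup>2)\<^sup>2 \<partial>lebesgue) powr (1 / 2)) powr (1 / 2)"
    by (simp only: powr_powr)
  finally show ?thesis by (simp add: powr_half_sqrt Lp_norm_2_eq del: powr_powr)
qed

text \<open>Hoelder's inequality with exponents 4, 4 and 2 for \<open>w\<close>, the indicator of
  the support and the bump, obtained from two applications of Cauchy-Schwarz. The fourth root of the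
  volume appears as a nested square root.\<close>

lemma inner_bump_le:
  fixes w :: "'a::euclidean_space \<Rightarrow> real"
  assumes w2: "w \<in> Lp_space 2" and w4: "w \<in> Lp_space 4"
  shows "(\<integral>x. w x * bump n x \<partial>lebesgue) \<le>
    Lp_norm 4 w * sqrt (sqrt (measure lborel (ball (0 :: 'a) ((1/2) ^ n)))) * Lp_norm 2 (bump n :: 'a \<Rightarrow> real)"
proof -
  let ?i = "indicator (ball (0 :: 'a) ((1/2) ^ n)) :: 'a \<Rightarrow> real"
  note w2 [measurable]
  have i2: "?i \<in> Lp_space 2" by (rule indicator_ball_L2)
  note i2 [measurable]
  have ww: "(\<lambda>x. (w x)\<^sup>2) \<in> Lp_space 2"
    unfolding Lp_space_2_iff power2_power2 using w4 by (auto simp: Lp_space_def)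
  have sq: "(w x * ?i x)\<^sup>2 = (w x)\<^sup>2 * ?i x" for x by (simp add: indicator_def)
  have wi: "(\<lambda>x. w x * ?i x) \<in> Lp_space 2"
    unfolding Lp_space_2_iff sq by (intro conjI Lp_space_2_mult_integrable ww i2) measurable
  have "(\<integral>x. w x * bump n x \<partial>lebesgue) = (\<integral>x. (w x * ?i x) * bump n x \<partial>lebesgue)"
    by (intro Bochner_Integration.integral_cong refl) (auto simp: indicator_def bump_eq_0)
  also have "\<dots> \<le> Lp_norm 2 (\<lambda>x. w x * ?i x) * Lp_norm 2 (bump n :: 'a \<Rightarrow> real)"
    by (rule Lp_norm_2_Cauchy_Schwarz[OF wi bump_L2])
  also have "\<dots> \<le> (Lp_norm 4 w * sqrt (sqrt (measure lborel (ball (0 :: 'a) ((1/2) ^ n))))) * Lp_norm 2 (bump n :: 'a \<Rightarrow> real)"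
  proof (rule mult_right_mono)
    have "(\<integral>x. (w x)\<^sup>2 * ?i x \<partial>lebesgue) \<le> Lp_norm 2 (\<lambda>x. (w x)\<^sup>2) * Lp_norm 2 ?i"
      by (rule Lp_norm_2_Cauchy_Schwarz[OF ww i2])
    also have "Lp_norm 2 ?i = sqrt (measure lborel (ball (0 :: 'a) ((1/2) ^ n)))"
    proof -
      have "(\<lambda>x. (?i x)\<^sup>2) = ?i" by (auto simp: indicator_def)
      then show ?thesis by (simp add: Lp_norm_2_eq)
    qed
    finally show "Lp_norm 2 (\<lambda>x. w x * ?i x) \<le> Lp_norm 4 w * sqrt (sqrt (measure lborel (ball (0 :: 'a) ((1/2) ^ n))))"
      unfolding Lp_norm_2_eq[of "\<lambda>x. w x * ?i x"] sq Lp_norm_4_eq real_sqrt_mult[symmetric]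
      by (rule real_sqrt_le_mono)
  qed (simp add: Lp_norm_2_eq)
  finally show ?thesis .
qed

theorem theorem5p4:
  fixes J :: "'a::euclidean_space \<Rightarrow> 'a \<Rightarrow> real" and c :: real
  assumes "levy_kernel J"
    and "c > 0"
    and "\<And>x y. 0 < norm (x - y) \<Longrightarrow> norm (x - y) < 1 \<Longrightarrow>
           J x y \<le> c * norm (x - y) powr (- real DIM('a))"
  shows "\<not> supercontractive J"
proof
  note J = assms(1)
  assume "supercontractive J"
  then obtain B where B0: "\<And>t q. 0 < t \<Longrightarrow> 2 \<le> q \<Longrightarrow> 0 \<le> B t q"
    and B: "\<And>t q u0 u. 0 < t \<Longrightarrow> 2 \<le> q \<Longrightarrow> u0 \<in> Lp_space 2 \<Longrightarrow> levy_solution J u0 u \<Longrightarrow>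
      u t \<in> Lp_space q \<and> Lp_norm q (u t) \<le> B t q * Lp_norm 2 u0"
    unfolding supercontractive_def by blast
  obtain C where C: "0 < C" "\<And>n. bump n \<in> H_space J"
    "\<And>n. energy J (bump n) (bump n) \<le> C * (1 + real n) * (\<integral>x. (bump n (x :: 'a))\<^sup>2 \<partial>lebesgue)"
    using bump_energy_bound[OF assms] by blast
  define \<omega> where "\<omega> = measure lborel (ball (0 :: 'a) 1)"
  \<comment> \<open>The fourth root of \<open>1/2\<close>, the decay rate in \<open>n\<close> of the
    upper bound; \<open>p\<close> is then any rate strictly between \<open>q\<close> and 1.\<close>
  define q where "q = sqrt (sqrt (1/2 :: real))"
  define p where "p = sqrt q"
  have q: "0 < q" "q < 1" by (simp_all add: q_def)
  have p: "q < p" "p < 1" "0 < p"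
  proof -
    show "0 < p" "p < 1" using q by (simp_all add: p_def)
    then have "p * p < p * 1" by (intro mult_strict_left_mono)
    then show "q < p" using q by (simp add: p_def)
  qed
  \<comment> \<open>Solves \<open>2 * C * T = - ln p\<close>. With a Rayleigh quotient of at most
    \<open>C * (1 + n)\<close> the exponential in the lower bound is at least
    \<open>p ^ Suc n\<close>.\<close>
  define T where "T = - ln p / (2 * C)"
  have "ln p < 0" using p by simp
  then have T: "0 < T" using C by (simp add: T_def divide_neg_pos)
  \<comment> \<open>The factor 4 clears the quarter in the lower bound for the pairing.\<close>
  define b where "b = 4 * B T 4 * sqrt (sqrt \<omega>)"
  interpret closed_form "form_domain J" "form_energy J" by (rule closed_form_levy[OF J])
  have main: "p ^ Suc n \<le> b * q ^ n" for n
  proof -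
    define f where "f = abs_L2 (bump n :: 'a \<Rightarrow> real)"
    have ae: "AE x in lebesgue. rep_L2 f x = bump n x"
      unfolding f_def by (rule rep_abs_L2[OF bump_L2])
    then have ae': "AE x in lebesgue. bump n x = rep_L2 f x" by eventually_elim simp
    have nf: "norm f = Lp_norm 2 (bump n :: 'a \<Rightarrow> real)" unfolding f_def by (rule norm_L2_abs[OF bump_L2])
    have nf2: "(norm f)\<^sup>2 = (\<integral>x. (bump n (x :: 'a))\<^sup>2 \<partial>lebesgue)"
      unfolding nf Lp_norm_2_eq by simp
    have "0 < (\<integral>x. (bump n (x :: 'a))\<^sup>2 \<partial>lebesgue)"
      by (rule less_le_trans[OF _ bump_norm_lower]) (intro mult_pos_pos zero_less_power content_ball_pos; simp)
    then have f2: "0 < (norm f)\<^sup>2" by (simp only: nf2)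
    then have f0: "f \<noteq> 0" by (metis less_irrefl norm_zero zero_power2)
    have fD: "f \<in> form_domain J"
      unfolding form_domain_def mem_Collect_eq by (rule H_space_cong_AE[OF J rep_L2_in ae' C(2)])
    have "form_energy J f f = energy J (bump n) (bump n)"
      unfolding form_energy_def
      by (rule energy_cong_AE[OF J _ _ _ _ ae ae]) (rule rep_L2_measurable bump_measurable_lebesgue)+
    then have "form_energy J f f \<le> C * (1 + real n) * (norm f)\<^sup>2" using C(3)[of n] nf2 by simp
    then have "form_energy J f f / (norm f)\<^sup>2 \<le> C * (1 + real n)" using f2 by (simp add: divide_le_eq)
    then have "2 * T * (form_energy J f f / (norm f)\<^sup>2) \<le> 2 * T * (C * (1 + real n))"
      using T by (intro mult_left_mono) auto
    also have "\<dots> = - (real (Suc n) * ln p)" using C by (simp add: T_def)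
    finally have "real (Suc n) * ln p \<le> - (2 * T * form_energy J f f / (norm f)\<^sup>2)" by simp
    then have "exp (real (Suc n) * ln p) \<le> exp (- (2 * T * form_energy J f f / (norm f)\<^sup>2))"
      unfolding exp_le_cancel_iff .
    then have pe: "p ^ Suc n \<le> exp (- (2 * T * form_energy J f f / (norm f)\<^sup>2))"
      using p by (simp only: exp_of_nat_mult exp_ln)
    obtain U V where UV: "classical_solution U V" and U0: "norm (U 0) \<le> norm f"
      and low: "(norm f)\<^sup>2 / 4 * exp (- (2 * T * form_energy J f f / (norm f)\<^sup>2)) \<le> U T \<bullet> f"
      using solution_inner_lower_bound[OF fD f0 T] by blast
    have sol: "rep_L2 (U T) \<in> Lp_space 4 \<and> Lp_norm 4 (rep_L2 (U T)) \<le> B T 4 * Lp_norm 2 (rep_L2 (U 0))"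
      using B[OF T _ rep_L2_in levy_solution_of_classical[OF J UV], of 4] by simp
    have "(norm f)\<^sup>2 / 4 * p ^ Suc n \<le> U T \<bullet> f"
      by (rule order_trans[OF mult_left_mono[OF pe] low]) simp
    also have "\<dots> = (\<integral>x. rep_L2 (U T) x * bump n x \<partial>lebesgue)"
      unfolding f_def by (metis abs_rep_L2 bump_L2 inner_L2_abs rep_L2_in)
    also have "\<dots> \<le> Lp_norm 4 (rep_L2 (U T)) * sqrt (sqrt (measure lborel (ball (0 :: 'a) ((1/2) ^ n)))) * norm f"
      unfolding nf by (rule inner_bump_le) (use sol in auto)
    also have "\<dots> \<le> (B T 4 * norm f) * (sqrt (sqrt \<omega>) * q ^ n) * norm f"
    proof (intro mult_right_mono mult_mono)
      have "Lp_norm 4 (rep_L2 (U T)) \<le> B T 4 * norm (U 0)" using sol by (simp add: Lp_norm_2_rep)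
      also have "\<dots> \<le> B T 4 * norm f" using U0 B0[OF T, of 4] by (intro mult_left_mono) auto
      finally show "Lp_norm 4 (rep_L2 (U T)) \<le> B T 4 * norm f" .
      \<comment> \<open>As the dimension is at least 1, the volume decays at least like
        \<open>(1/2) ^ n\<close>, which makes the rate \<open>q\<close> independent of it.\<close>
      have "((1/2) ^ n) ^ DIM('a) \<le> ((1/2 :: real) ^ n) ^ 1"
        by (intro power_decreasing) (auto simp: power_le_one Suc_le_eq)
      then have "measure lborel (ball (0 :: 'a) ((1/2) ^ n)) \<le> \<omega> * (1/2) ^ n"
        by (simp add: content_ball_conv_unit_ball[of "(1/2) ^ n"] \<omega>_def mult_left_mono mult.commute)
      then have "sqrt (sqrt (measure lborel (ball (0 :: 'a) ((1/2) ^ n)))) \<le> sqrt (sqrt (\<omega> * (1/2) ^ n))"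
        by simp
      also have "\<dots> = sqrt (sqrt \<omega>) * q ^ n"
        by (simp only: real_sqrt_mult real_sqrt_power q_def)
      finally show "sqrt (sqrt (measure lborel (ball (0 :: 'a) ((1/2) ^ n)))) \<le> sqrt (sqrt \<omega>) * q ^ n" .
    qed (use B0[OF T, of 4] in auto)
    finally have "(norm f)\<^sup>2 * p ^ Suc n \<le> (norm f)\<^sup>2 * (b * q ^ n)"
      by (simp add: b_def power2_eq_square mult_ac)
    then show ?thesis using f2 by (simp only: mult_le_cancel_left_pos)
  qed
  \<comment> \<open>The lower bound decays more slowly than the upper one, so their ratio would keep
    the powers of a number above 1 bounded.\<close>
  have "(p / q) ^ n \<le> b / p" for n
  proof -
    have "p * p ^ n / q ^ n \<le> b" using main[of n] q by (simp add: pos_divide_le_eq)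
    then have "(p / q) ^ n * p \<le> b" by (simp add: power_divide mult.commute)
    then show ?thesis using p by (simp only: pos_le_divide_eq)
  qed
  moreover have "1 < p / q" using p q by simp
  ultimately show False using real_arch_pow[of "p / q" "b / p"] by (meson not_le)
qed

end
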